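(* Let $(\mathcal X,\mathcal Y,\mathcal Z)$ be an (additive) TTF triple on an additive category $\mathcal D$. The following assertions are equivalent: 1) $(\mathcal X,\mathcal Y,\mathcal Z)$ is left split and $\mathcal X=\mathcal Z$. 2) $(\mathcal X,\mathcal Y,\mathcal Z)$ is right split and $\mathcal X=\mathcal Z$. 3) $(\mathcal X,\mathcal Y,\mathcal Z)$ is centrally split. When $\mathcal D$ has canonical factorizations, or when $\mathcal D$ is a weakly balanced pretriangulated category and both $(\mathcal X,\mathcal Y)$ and $(\mathcal Y,\mathcal Z)$ are pretriangulated torsion pairs, conditions 1), 2) and 3) are equivalent to: 4) $\mathcal X=\mathcal Z$.
   Context: "Strictly full" means full and closed under isomorphisms. In an additive category, $L\xrightarrow{f}M\xrightarrow{g}N$ is weakly exact if $\mathcal D(?,L)\to\mathcal D(?,M)\to\mathcal D(?,N)$ and $\mathcal D(N,?)\to\mathcal D(M,?)\to\mathcal D(L,?)$ are exact (at the middle term). An (additive) torsion pair on $\mathcal D$ is a pair $(\mathcal X,\mathcal Y)$ of strictly full subcategories such that: (i) $\mathcal D(X,Y)=0$ for $X\in\mathcal X$, $Y\in\mathcal Y$; (ii) the inclusion $x:\mathcal X\to\mathcal D$ has a right adjoint $\tau_{\mathcal X}$, with counit $\delta_{\mathcal X}$; (iii) the inclusion $y:\mathcal Y\to\mathcal D$ has a left adjoint $\tau^{\mathcal Y}$, with unit $\eta^{\mathcal Y}$; (iv) for each $M\in\mathcal D$ the torsion sequence $x\tau_{\mathcal X}M\xrightarrow{\delta_{\mathcal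 X,M}}M\xrightarrow{\eta^{\mathcal Y}_M}y\tau^{\mathcal Y}M$ is weakly exact. It is split if every $\delta_{\mathcal X,M}$ is a section (equivalently every $\eta^{\mathcal Y}_M$ is a retraction). A TTF triple on $\mathcal D$ is a triple $(\mathcal X,\mathcal Y,\mathcal Z)$ of full subcategories such that $(\mathcal X,\mathcal Y)$ and $(\mathcal Y,\mathcal Z)$ are torsion pairs. It is left split if $(\mathcal X,\mathcal Y)$ is split, right split if $(\mathcal Y,\mathcal Z)$ is split, centrally split if both are. $\mathcal D$ has canonical factorizations if every morphism factors as an epimorphism followed by a monomorphism, and any two such factorizations $M\xrightarrow{p}L\xrightarrow{i}N$, $M\xrightarrow{p'}L'\xrightarrow{i'}N$ of the same morphism are related by an isomorphism $g:L\to L'$ with $gp=p'$, $i'g=i$. A right triangulated (=suspended) category is an additive category $\mathcal D$ with an additive endofunctor $\Sigma$ and a class, closed under isomorphisms, of diagrams $L\xrightarrow{f}M\xrightarrow{g}N\xrightarrow{h}\Sigma L$ (right triangles) such that: (RT1) $0\to M\xrightarrow{1}M\to 0$ is a right triangle for each $M$; (RT2) if $(f,g,h)$ is a right triangle so is $(g,h,-\Sigma f)$; (RT3) given right triangles $(f,g,h)$, $(f',g',h')$ and morphisms $l,m$ with $mf=f'l$, there is $n$ such that $(l,m,n)$ is a morphism of triangles; (RT4) for each pair of morphisms $L\xrightarrow{f}M\xrightarrow{g}N$ there are right triangles $L\xrightarrow{f}M\xrightarrow{m}N'\to\Sigma L$, $L\xrightarrow{gf}N\to M'\to\Sigma L$,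 $M\xrightarrow{g}N\to L'\xrightarrow{l}\Sigma M$ and $N'\to M'\to L'\to\Sigma N'$, the last morphism being $(\Sigma m)l$, forming the usual commutative octahedral diagram. A left triangulated category $(\mathcal D,\Omega)$ is defined dually, with left triangles $\Omega N\to L\to M\to N$. A pretriangulated category (in the sense of Beligiannis) is an additive category $\mathcal D$ with an adjoint pair $(\Sigma,\Omega)$ of additive endofunctors ($\Sigma$ left adjoint to $\Omega$, with unit $\eta$ and counit $\delta$), a left triangulated structure on $(\mathcal D,\Omega)$ and a right triangulated structure on $(\mathcal D,\Sigma)$, such that for every right triangle $L\xrightarrow{f}M\xrightarrow{g}N\xrightarrow{h}\Sigma L$ and left triangle $\Omega N'\xrightarrow{f'}L'\xrightarrow{g'}M'\xrightarrow{h'}N'$: given $l:L\to\Omega N'$, $m:M\to L'$ with $mf=f'l$ there is $n:N\to M'$ with $ng=g'm$ and $h'n=\delta_{N'}(\Sigma l)h$; and given $n':N\to M'$, $l':\Sigma L\to N'$ with $l'h=h'n'$ there is $m':M\to L'$ with $g'm'=n'g$ and $m'f=f'(\Omega l')\eta_L$. It is weakly balanced if a morphism $f:M\to N$ is an isomorphism whenever there exist a left triangle $\Omega N\to 0\to M\xrightarrow{f}N$ and a right triangle $M\xrightarrow{f}N\to 0\to\Sigma M$. A pretriangulated torsion pair on a pretriangulated category is an additive torsion pair $(\mathcal X,\mathcal Y)$ such that $\Sigma\mathcal X\subseteq\mathcal X$ (equivalently $\Omega\mathcal Y\subseteq\mathcal Y$) and every torsion sequence $x\tau_{\mathcal X}M\to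 M\to y\tau^{\mathcal Y}M$ is both the beginning of a right triangle and the end of a left triangle. *)

theory Defs
  imports "HOL-Algebra.Group"
begin

section \<open>Categories\<close>

record ('o, 'a) cat =
  Ob :: "'o set"
  Arr :: "'a set"
  Dom :: "'a \<Rightarrow> 'o"
  Cod :: "'a \<Rightarrow> 'o"
  Ident :: "'o \<Rightarrow> 'a"
  Comp :: "'a \<Rightarrow> 'a \<Rightarrow> 'a"  (infixr \<open>\<cdot>\<index>\<close> 70)

text \<open>The composite \<open>g \<cdot> f\<close> means ``first \<open>f\<close>, then \<open>g\<close>''.\<close>

definition Hom :: "('o, 'a, 'm) cat_scheme \<Rightarrow> 'o \<Rightarrow> 'o \<Rightarrow> 'a set" where
  "Hom D A B = {f \<in> Arr D. Dom D f = A \<and> Cod D f = B}"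

definition is_category :: "('o, 'a, 'm) cat_scheme \<Rightarrow> bool" where
  "is_category D \<longleftrightarrow>
     (\<forall>f\<in>Arr D. Dom D f \<in> Ob D \<and> Cod D f \<in> Ob D) \<and>
     (\<forall>A\<in>Ob D. Ident D A \<in> Hom D A A) \<and>
     (\<forall>A B C. \<forall>f\<in>Hom D A B. \<forall>g\<in>Hom D B C. g \<cdot>\<^bsub>D\<^esub> f \<in> Hom D A C) \<and>
     (\<forall>A B. \<forall>f\<in>Hom D A B. f \<cdot>\<^bsub>D\<^esub> Ident D A = f \<and> Ident D B \<cdot>\<^bsub>D\<^esub> f = f) \<and>
     (\<forall>A B C E. \<forall>f\<in>Hom D A B. \<forall>g\<in>Hom D B C. \<forall>h\<in>Hom D C E.
        h \<cdot>\<^bsub>D\<^esub> (g \<cdot>\<^bsub>D\<^esub> f) = (h \<cdot>\<^bsub>D\<^esub> g) \<cdot>\<^bsub>D\<^esub> f)"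

definition is_iso :: "('o, 'a, 'm) cat_scheme \<Rightarrow> 'a \<Rightarrow> bool" where
  "is_iso D f \<longleftrightarrow> f \<in> Arr D \<and>
     (\<exists>g\<in>Hom D (Cod D f) (Dom D f).
        g \<cdot>\<^bsub>D\<^esub> f = Ident D (Dom D f) \<and> f \<cdot>\<^bsub>D\<^esub> g = Ident D (Cod D f))"

definition isomorphic :: "('o, 'a, 'm) cat_scheme \<Rightarrow> 'o \<Rightarrow> 'o \<Rightarrow> bool" where
  "isomorphic D A B \<longleftrightarrow> (\<exists>f\<in>Hom D A B. is_iso D f)"

definition is_mono :: "('o, 'a, 'm) cat_scheme \<Rightarrow> 'a \<Rightarrow> bool" where
  "is_mono D f \<longleftrightarrow> f \<in> Arr D \<and>
     (\<forall>T. \<forall>u\<in>Hom D T (Dom D f). \<forall>v\<in>Hom D T (Dom D f). f \<cdot>\<^bsub>D\<^esub> u = f \<cdot>\<^bsub>D\<^esub> v \<longrightarrow> u = v)"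

definition is_epi :: "('o, 'a, 'm) cat_scheme \<Rightarrow> 'a \<Rightarrow> bool" where
  "is_epi D f \<longleftrightarrow> f \<in> Arr D \<and>
     (\<forall>T. \<forall>u\<in>Hom D (Cod D f) T. \<forall>v\<in>Hom D (Cod D f) T. u \<cdot>\<^bsub>D\<^esub> f = v \<cdot>\<^bsub>D\<^esub> f \<longrightarrow> u = v)"

text \<open>Sections are the split monomorphisms.\<close>

definition is_section :: "('o, 'a, 'm) cat_scheme \<Rightarrow> 'a \<Rightarrow> bool" where
  "is_section D f \<longleftrightarrow> f \<in> Arr D \<and>
     (\<exists>r\<in>Hom D (Cod D f) (Dom D f). r \<cdot>\<^bsub>D\<^esub> f = Ident D (Dom D f))"

definition epi_mono_factorization ::
  "('o, 'a, 'm) cat_scheme \<Rightarrow> 'a \<Rightarrow> 'a \<Rightarrow> 'a \<Rightarrow> bool" where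
  "epi_mono_factorization D f p i \<longleftrightarrow>
     is_epi D p \<and> is_mono D i \<and> Cod D p = Dom D i \<and> f = i \<cdot>\<^bsub>D\<^esub> p"

definition canonical_factorizations :: "('o, 'a, 'm) cat_scheme \<Rightarrow> bool" where
  "canonical_factorizations D \<longleftrightarrow>
     (\<forall>f\<in>Arr D.
        (\<exists>p i. epi_mono_factorization D f p i) \<and>
        (\<forall>p i p' i'. epi_mono_factorization D f p i \<and> epi_mono_factorization D f p' i' \<longrightarrow>
           (\<exists>g\<in>Hom D (Cod D p) (Cod D p').
              is_iso D g \<and> g \<cdot>\<^bsub>D\<^esub> p = p' \<and> i' \<cdot>\<^bsub>D\<^esub> g = i)))"


section \<open>Functors and adjunctions\<close>

record ('o, 'a, 'p, 'b) cat_functor =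
  FOb :: "'o \<Rightarrow> 'p"
  FArr :: "'a \<Rightarrow> 'b"

definition is_functor ::
  "('o, 'a, 'm) cat_scheme \<Rightarrow> ('p, 'b, 'n) cat_scheme \<Rightarrow> ('o, 'a, 'p, 'b) cat_functor \<Rightarrow> bool" where
  "is_functor C D F \<longleftrightarrow>
     (\<forall>A\<in>Ob C. FOb F A \<in> Ob D) \<and>
     (\<forall>A B. \<forall>f\<in>Hom C A B. FArr F f \<in> Hom D (FOb F A) (FOb F B)) \<and>
     (\<forall>A\<in>Ob C. FArr F (Ident C A) = Ident D (FOb F A)) \<and>
     (\<forall>A B E. \<forall>f\<in>Hom C A B. \<forall>g\<in>Hom C B E.
        FArr F (g \<cdot>\<^bsub>C\<^esub> f) = FArr F g \<cdot>\<^bsub>D\<^esub> FArr F f)"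

definition functor_id :: "('o, 'a, 'o, 'a) cat_functor" where
  "functor_id = \<lparr>FOb = \<lambda>A. A, FArr = \<lambda>f. f\<rparr>"

definition functor_comp ::
  "('p, 'b, 'q, 'c) cat_functor \<Rightarrow> ('o, 'a, 'p, 'b) cat_functor \<Rightarrow> ('o, 'a, 'q, 'c) cat_functor" where
  "functor_comp G F = \<lparr>FOb = \<lambda>A. FOb G (FOb F A), FArr = \<lambda>f. FArr G (FArr F f)\<rparr>"

definition natural_transformation ::
  "('o, 'a, 'm) cat_scheme \<Rightarrow> ('p, 'b, 'n) cat_scheme \<Rightarrow>
   ('o, 'a, 'p, 'b) cat_functor \<Rightarrow> ('o, 'a, 'p, 'b) cat_functor \<Rightarrow> ('o \<Rightarrow> 'b) \<Rightarrow> bool" where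
  "natural_transformation C D F G \<alpha> \<longleftrightarrow>
     (\<forall>A\<in>Ob C. \<alpha> A \<in> Hom D (FOb F A) (FOb G A)) \<and>
     (\<forall>A B. \<forall>f\<in>Hom C A B. \<alpha> B \<cdot>\<^bsub>D\<^esub> FArr F f = FArr G f \<cdot>\<^bsub>D\<^esub> \<alpha> A)"

text \<open>\<open>F : C \<rightarrow> D\<close> is left adjoint to \<open>G : D \<rightarrow> C\<close> with unit \<open>\<eta>\<close> and counit \<open>\<epsilon>\<close>.\<close>

definition adjunction ::
  "('o, 'a, 'm) cat_scheme \<Rightarrow> ('p, 'b, 'n) cat_scheme \<Rightarrow>
   ('o, 'a, 'p, 'b) cat_functor \<Rightarrow> ('p, 'b, 'o, 'a) cat_functor \<Rightarrow>
   ('o \<Rightarrow> 'a) \<Rightarrow> ('p \<Rightarrow> 'b) \<Rightarrow> bool" where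
  "adjunction C D F G \<eta> \<epsilon> \<longleftrightarrow>
     is_functor C D F \<and> is_functor D C G \<and>
     natural_transformation C C functor_id (functor_comp G F) \<eta> \<and>
     natural_transformation D D (functor_comp F G) functor_id \<epsilon> \<and>
     (\<forall>A\<in>Ob C. \<epsilon> (FOb F A) \<cdot>\<^bsub>D\<^esub> FArr F (\<eta> A) = Ident D (FOb F A)) \<and>
     (\<forall>B\<in>Ob D. FArr G (\<epsilon> B) \<cdot>\<^bsub>C\<^esub> \<eta> (FOb G B) = Ident C (FOb G B))"

text \<open>A full subcategory is given by its set of objects.\<close>

definition full_sub :: "('o, 'a, 'm) cat_scheme \<Rightarrow> 'o set \<Rightarrow> ('o, 'a, 'm) cat_scheme" where
  "full_sub D X = D\<lparr>Ob := X, Arr := {f \<in> Arr D. Dom D f \<in> X \<and> Cod D f \<in> X}\<rparr>"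

definition strictly_full :: "('o, 'a, 'm) cat_scheme \<Rightarrow> 'o set \<Rightarrow> bool" where
  "strictly_full D X \<longleftrightarrow> X \<subseteq> Ob D \<and> (\<forall>A\<in>X. \<forall>B\<in>Ob D. isomorphic D A B \<longrightarrow> B \<in> X)"

text \<open>The inclusion of a full subcategory acts as \<^const>\<open>functor_id\<close> on objects and arrows.\<close>

definition inclusion_right_adjoint ::
  "('o, 'a, 'm) cat_scheme \<Rightarrow> 'o set \<Rightarrow> ('o, 'a, 'o, 'a) cat_functor \<Rightarrow> ('o \<Rightarrow> 'a) \<Rightarrow> bool" where
  "inclusion_right_adjoint D X \<tau> \<delta> \<longleftrightarrow> (\<exists>\<eta>. adjunction (full_sub D X) D functor_id \<tau> \<eta> \<delta>)"

definition inclusion_left_adjoint ::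
  "('o, 'a, 'm) cat_scheme \<Rightarrow> 'o set \<Rightarrow> ('o, 'a, 'o, 'a) cat_functor \<Rightarrow> ('o \<Rightarrow> 'a) \<Rightarrow> bool" where
  "inclusion_left_adjoint D Y \<sigma> \<eta> \<longleftrightarrow> (\<exists>\<delta>. adjunction D (full_sub D Y) \<sigma> functor_id \<eta> \<delta>)"


section \<open>Additive categories\<close>

record ('o, 'a) addcat = "('o, 'a) cat" +
  Plus :: "'a \<Rightarrow> 'a \<Rightarrow> 'a"  (infixl \<open>\<boxplus>\<index>\<close> 65)
  Zer :: "'o \<Rightarrow> 'o \<Rightarrow> 'a"

definition hom_group :: "('o, 'a, 'm) addcat_scheme \<Rightarrow> 'o \<Rightarrow> 'o \<Rightarrow> 'a monoid" where
  "hom_group D A B = \<lparr>carrier = Hom D A B, mult = Plus D, one = Zer D A B\<rparr>"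

definition Neg :: "('o, 'a, 'm) addcat_scheme \<Rightarrow> 'a \<Rightarrow> 'a" where
  "Neg D f = inv\<^bsub>hom_group D (Dom D f) (Cod D f)\<^esub> f"

definition zero_object :: "('o, 'a, 'm) cat_scheme \<Rightarrow> 'o \<Rightarrow> bool" where
  "zero_object D N \<longleftrightarrow> N \<in> Ob D \<and> (\<forall>A\<in>Ob D. (\<exists>!f. f \<in> Hom D A N) \<and> (\<exists>!f. f \<in> Hom D N A))"

definition is_biproduct ::
  "('o, 'a, 'm) addcat_scheme \<Rightarrow> 'o \<Rightarrow> 'o \<Rightarrow> 'o \<Rightarrow> 'a \<Rightarrow> 'a \<Rightarrow> 'a \<Rightarrow> 'a \<Rightarrow> bool" where
  "is_biproduct D A B S i j p q \<longleftrightarrow>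
     S \<in> Ob D \<and> i \<in> Hom D A S \<and> j \<in> Hom D B S \<and> p \<in> Hom D S A \<and> q \<in> Hom D S B \<and>
     p \<cdot>\<^bsub>D\<^esub> i = Ident D A \<and> q \<cdot>\<^bsub>D\<^esub> j = Ident D B \<and>
     p \<cdot>\<^bsub>D\<^esub> j = Zer D B A \<and> q \<cdot>\<^bsub>D\<^esub> i = Zer D A B \<and>
     (i \<cdot>\<^bsub>D\<^esub> p) \<boxplus>\<^bsub>D\<^esub> (j \<cdot>\<^bsub>D\<^esub> q) = Ident D S"

definition additive_category :: "('o, 'a, 'm) addcat_scheme \<Rightarrow> bool" where
  "additive_category D \<longleftrightarrow>
     is_category D \<and>
     (\<forall>A\<in>Ob D. \<forall>B\<in>Ob D. comm_group (hom_group D A B)) \<and>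
     (\<forall>A B C. \<forall>f\<in>Hom D A B. \<forall>f'\<in>Hom D A B. \<forall>g\<in>Hom D B C.
        g \<cdot>\<^bsub>D\<^esub> (f \<boxplus>\<^bsub>D\<^esub> f') = (g \<cdot>\<^bsub>D\<^esub> f) \<boxplus>\<^bsub>D\<^esub> (g \<cdot>\<^bsub>D\<^esub> f')) \<and>
     (\<forall>A B C. \<forall>f\<in>Hom D A B. \<forall>g\<in>Hom D B C. \<forall>g'\<in>Hom D B C.
        (g \<boxplus>\<^bsub>D\<^esub> g') \<cdot>\<^bsub>D\<^esub> f = (g \<cdot>\<^bsub>D\<^esub> f) \<boxplus>\<^bsub>D\<^esub> (g' \<cdot>\<^bsub>D\<^esub> f)) \<and>
     (\<exists>N. zero_object D N) \<and>
     (\<forall>A\<in>Ob D. \<forall>B\<in>Ob D. \<exists>S i j p q. is_biproduct D A B S i j p q)"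

definition additive_endofunctor ::
  "('o, 'a, 'm) addcat_scheme \<Rightarrow> ('o, 'a, 'o, 'a) cat_functor \<Rightarrow> bool" where
  "additive_endofunctor D F \<longleftrightarrow> is_functor D D F \<and>
     (\<forall>A B. \<forall>f\<in>Hom D A B. \<forall>g\<in>Hom D A B. FArr F (f \<boxplus>\<^bsub>D\<^esub> g) = FArr F f \<boxplus>\<^bsub>D\<^esub> FArr F g)"

definition opposite :: "('o, 'a, 'm) addcat_scheme \<Rightarrow> ('o, 'a, 'm) addcat_scheme" where
  "opposite D = D\<lparr>Dom := Cod D, Cod := Dom D, Comp := (\<lambda>g f. f \<cdot>\<^bsub>D\<^esub> g),
                  Zer := (\<lambda>A B. Zer D B A)\<rparr>"

text \<open>For \<open>f : L \<rightarrow> M\<close> and \<open>g : M \<rightarrow> N\<close>: exactness, at the middle term, of the two sequences of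
  abelian groups obtained by applying \<open>D(T, -)\<close> and \<open>D(-, T)\<close>, stated as image = kernel.\<close>

definition weakly_exact :: "('o, 'a, 'm) addcat_scheme \<Rightarrow> 'a \<Rightarrow> 'a \<Rightarrow> bool" where
  "weakly_exact D f g \<longleftrightarrow>
     f \<in> Arr D \<and> g \<in> Arr D \<and> Cod D f = Dom D g \<and>
     (\<forall>T\<in>Ob D. {f \<cdot>\<^bsub>D\<^esub> u | u. u \<in> Hom D T (Dom D f)} =
               {v \<in> Hom D T (Cod D f). g \<cdot>\<^bsub>D\<^esub> v = Zer D T (Cod D g)}) \<and>
     (\<forall>T\<in>Ob D. {u \<cdot>\<^bsub>D\<^esub> g | u. u \<in> Hom D (Cod D g) T} =
               {v \<in> Hom D (Dom D g) T. v \<cdot>\<^bsub>D\<^esub> f = Zer D (Dom D f) T})"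


section \<open>Torsion pairs and TTF triples\<close>

definition torsion_pair :: "('o, 'a, 'm) addcat_scheme \<Rightarrow> 'o set \<Rightarrow> 'o set \<Rightarrow> bool" where
  "torsion_pair D X Y \<longleftrightarrow>
     strictly_full D X \<and> strictly_full D Y \<and>
     (\<forall>A\<in>X. \<forall>B\<in>Y. Hom D A B = {Zer D A B}) \<and>
     (\<exists>\<tau> \<delta> \<sigma> \<eta>. inclusion_right_adjoint D X \<tau> \<delta> \<and> inclusion_left_adjoint D Y \<sigma> \<eta> \<and>
        (\<forall>M\<in>Ob D. weakly_exact D (\<delta> M) (\<eta> M)))"

text \<open>Adjoints are unique up to isomorphism, so being split does not depend on the choice of the
  right adjoint; it is stated for all choices (one exists by \<^const>\<open>torsion_pair\<close>).\<close>

definition split_torsion_pair :: "('o, 'a, 'm) addcat_scheme \<Rightarrow> 'o set \<Rightarrow> 'o set \<Rightarrow> bool" where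
  "split_torsion_pair D X Y \<longleftrightarrow>
     torsion_pair D X Y \<and>
     (\<forall>\<tau> \<delta>. inclusion_right_adjoint D X \<tau> \<delta> \<longrightarrow> (\<forall>M\<in>Ob D. is_section D (\<delta> M)))"

definition TTF_triple ::
  "('o, 'a, 'm) addcat_scheme \<Rightarrow> 'o set \<Rightarrow> 'o set \<Rightarrow> 'o set \<Rightarrow> bool" where
  "TTF_triple D X Y Z \<longleftrightarrow> torsion_pair D X Y \<and> torsion_pair D Y Z"

definition left_split ::
  "('o, 'a, 'm) addcat_scheme \<Rightarrow> 'o set \<Rightarrow> 'o set \<Rightarrow> 'o set \<Rightarrow> bool" where
  "left_split D X Y Z \<longleftrightarrow> TTF_triple D X Y Z \<and> split_torsion_pair D X Y"

definition right_split ::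
  "('o, 'a, 'm) addcat_scheme \<Rightarrow> 'o set \<Rightarrow> 'o set \<Rightarrow> 'o set \<Rightarrow> bool" where
  "right_split D X Y Z \<longleftrightarrow> TTF_triple D X Y Z \<and> split_torsion_pair D Y Z"

definition centrally_split ::
  "('o, 'a, 'm) addcat_scheme \<Rightarrow> 'o set \<Rightarrow> 'o set \<Rightarrow> 'o set \<Rightarrow> bool" where
  "centrally_split D X Y Z \<longleftrightarrow> left_split D X Y Z \<and> right_split D X Y Z"


section \<open>One-sided triangulated and pretriangulated categories\<close>

text \<open>\<open>right_diagram D S f g h\<close>: a diagram \<open>L \<rightarrow> M \<rightarrow> N \<rightarrow> S L\<close> with arrows \<open>f\<close>, \<open>g\<close>, \<open>h\<close>.\<close>

definition right_diagram ::
  "('o, 'a, 'm) cat_scheme \<Rightarrow> ('o, 'a, 'o, 'a) cat_functor \<Rightarrow> 'a \<Rightarrow> 'a \<Rightarrow> 'a \<Rightarrow> bool" where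
  "right_diagram D S f g h \<longleftrightarrow>
     f \<in> Arr D \<and> g \<in> Hom D (Cod D f) (Cod D g) \<and> h \<in> Hom D (Cod D g) (FOb S (Dom D f))"

text \<open>\<open>(l, m, n)\<close> is a morphism of diagrams from \<open>(f, g, h)\<close> to \<open>(f', g', h')\<close>.\<close>

definition right_morphism ::
  "('o, 'a, 'm) cat_scheme \<Rightarrow> ('o, 'a, 'o, 'a) cat_functor \<Rightarrow>
   'a \<times> 'a \<times> 'a \<Rightarrow> 'a \<times> 'a \<times> 'a \<Rightarrow> 'a \<Rightarrow> 'a \<Rightarrow> 'a \<Rightarrow> bool" where
  "right_morphism D S t t' l m n \<longleftrightarrow>
     (case t of (f, g, h) \<Rightarrow> case t' of (f', g', h') \<Rightarrow>
        l \<in> Hom D (Dom D f) (Dom D f') \<and>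
        m \<in> Hom D (Cod D f) (Cod D f') \<and>
        n \<in> Hom D (Cod D g) (Cod D g') \<and>
        m \<cdot>\<^bsub>D\<^esub> f = f' \<cdot>\<^bsub>D\<^esub> l \<and> n \<cdot>\<^bsub>D\<^esub> g = g' \<cdot>\<^bsub>D\<^esub> m \<and> FArr S l \<cdot>\<^bsub>D\<^esub> h = h' \<cdot>\<^bsub>D\<^esub> n)"

text \<open>The last clause is the octahedral axiom; the commutative diagram is made of
    \<^item> rows \<open>L \<rightarrow> M \<rightarrow> N' \<rightarrow> S L\<close> (arrows \<open>f\<close>, \<open>m\<close>, \<open>a\<close>) and
      \<open>L \<rightarrow> N \<rightarrow> M' \<rightarrow> S L\<close> (arrows \<open>g \<cdot> f\<close>, \<open>p\<close>, \<open>q\<close>),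
    \<^item> columns \<open>M \<rightarrow> N \<rightarrow> L' \<rightarrow> S M\<close> (arrows \<open>g\<close>, \<open>r\<close>, \<open>l\<close>) and
      \<open>N' \<rightarrow> M' \<rightarrow> L' \<rightarrow> S N'\<close> (arrows \<open>u\<close>, \<open>v\<close>, \<open>S m \<cdot> l\<close>).\<close>

definition right_triangulated ::
  "('o, 'a, 'm) addcat_scheme \<Rightarrow> ('o, 'a, 'o, 'a) cat_functor \<Rightarrow> ('a \<times> 'a \<times> 'a) set \<Rightarrow> bool" where
  "right_triangulated D S \<T> \<longleftrightarrow>
     additive_category D \<and> additive_endofunctor D S \<and>
     (\<forall>f g h. (f, g, h) \<in> \<T> \<longrightarrow> right_diagram D S f g h) \<and>
     (\<forall>t\<in>\<T>. \<forall>f' g' h' l m n.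
        right_diagram D S f' g' h' \<and> right_morphism D S t (f', g', h') l m n \<and>
        is_iso D l \<and> is_iso D m \<and> is_iso D n \<longrightarrow> (f', g', h') \<in> \<T>) \<and>
     (\<forall>N M. zero_object D N \<and> M \<in> Ob D \<longrightarrow> (Zer D N M, Ident D M, Zer D M (FOb S N)) \<in> \<T>) \<and>
     (\<forall>f g h. (f, g, h) \<in> \<T> \<longrightarrow> (g, h, Neg D (FArr S f)) \<in> \<T>) \<and>
     (\<forall>f g h f' g' h' l m.
        (f, g, h) \<in> \<T> \<and> (f', g', h') \<in> \<T> \<and>
        l \<in> Hom D (Dom D f) (Dom D f') \<and> m \<in> Hom D (Cod D f) (Cod D f') \<and>
        m \<cdot>\<^bsub>D\<^esub> f = f' \<cdot>\<^bsub>D\<^esub> l \<longrightarrow>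
        (\<exists>n. right_morphism D S (f, g, h) (f', g', h') l m n)) \<and>
     (\<forall>L M N. \<forall>f\<in>Hom D L M. \<forall>g\<in>Hom D M N.
        \<exists>m a p q r l u v.
          (f, m, a) \<in> \<T> \<and> (g \<cdot>\<^bsub>D\<^esub> f, p, q) \<in> \<T> \<and> (g, r, l) \<in> \<T> \<and>
          (u, v, FArr S m \<cdot>\<^bsub>D\<^esub> l) \<in> \<T> \<and>
          u \<in> Hom D (Cod D m) (Cod D p) \<and> v \<in> Hom D (Cod D p) (Cod D r) \<and>
          u \<cdot>\<^bsub>D\<^esub> m = p \<cdot>\<^bsub>D\<^esub> g \<and> q \<cdot>\<^bsub>D\<^esub> u = a \<and>
          v \<cdot>\<^bsub>D\<^esub> p = r \<and> l \<cdot>\<^bsub>D\<^esub> v = FArr S f \<cdot>\<^bsub>D\<^esub> q)"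

text \<open>A left triangle \<open>W N \<rightarrow> L \<rightarrow> M \<rightarrow> N\<close> with arrows \<open>f\<close>, \<open>g\<close>, \<open>h\<close> is recorded as \<open>(f, g, h)\<close>; read
  in the opposite category it is the right-handed diagram \<open>(h, g, f)\<close>.\<close>

definition left_triangulated ::
  "('o, 'a, 'm) addcat_scheme \<Rightarrow> ('o, 'a, 'o, 'a) cat_functor \<Rightarrow> ('a \<times> 'a \<times> 'a) set \<Rightarrow> bool" where
  "left_triangulated D W \<T> \<longleftrightarrow>
     right_triangulated (opposite D) W {(h, g, f) | f g h. (f, g, h) \<in> \<T>}"

record ('o, 'a) pretri =
  Susp :: "('o, 'a, 'o, 'a) cat_functor"
  Loop :: "('o, 'a, 'o, 'a) cat_functor"
  Unit :: "'o \<Rightarrow> 'a"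
  Counit :: "'o \<Rightarrow> 'a"
  RTri :: "('a \<times> 'a \<times> 'a) set"
  LTri :: "('a \<times> 'a \<times> 'a) set"

definition pretriangulated :: "('o, 'a, 'm) addcat_scheme \<Rightarrow> ('o, 'a) pretri \<Rightarrow> bool" where
  "pretriangulated D P \<longleftrightarrow>
     additive_category D \<and>
     additive_endofunctor D (Susp P) \<and> additive_endofunctor D (Loop P) \<and>
     adjunction D D (Susp P) (Loop P) (Unit P) (Counit P) \<and>
     left_triangulated D (Loop P) (LTri P) \<and>
     right_triangulated D (Susp P) (RTri P) \<and>
     (\<forall>f g h f' g' h'. (f, g, h) \<in> RTri P \<and> (f', g', h') \<in> LTri P \<longrightarrow>
        (\<forall>l\<in>Hom D (Dom D f) (Dom D f'). \<forall>m\<in>Hom D (Cod D f) (Cod D f').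
           m \<cdot>\<^bsub>D\<^esub> f = f' \<cdot>\<^bsub>D\<^esub> l \<longrightarrow>
           (\<exists>n\<in>Hom D (Cod D g) (Cod D g').
              n \<cdot>\<^bsub>D\<^esub> g = g' \<cdot>\<^bsub>D\<^esub> m \<and>
              h' \<cdot>\<^bsub>D\<^esub> n = Counit P (Cod D h') \<cdot>\<^bsub>D\<^esub> FArr (Susp P) l \<cdot>\<^bsub>D\<^esub> h)) \<and>
        (\<forall>n'\<in>Hom D (Cod D g) (Cod D g'). \<forall>l'\<in>Hom D (FOb (Susp P) (Dom D f)) (Cod D h').
           l' \<cdot>\<^bsub>D\<^esub> h = h' \<cdot>\<^bsub>D\<^esub> n' \<longrightarrow>
           (\<exists>m'\<in>Hom D (Cod D f) (Cod D f').
              g' \<cdot>\<^bsub>D\<^esub> m' = n' \<cdot>\<^bsub>D\<^esub> g \<and>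
              m' \<cdot>\<^bsub>D\<^esub> f = f' \<cdot>\<^bsub>D\<^esub> FArr (Loop P) l' \<cdot>\<^bsub>D\<^esub> Unit P (Dom D f))))"

text \<open>Since triangles are closed under isomorphisms, the choice of zero object is immaterial.\<close>

definition weakly_balanced :: "('o, 'a, 'm) addcat_scheme \<Rightarrow> ('o, 'a) pretri \<Rightarrow> bool" where
  "weakly_balanced D P \<longleftrightarrow>
     (\<forall>f\<in>Arr D.
        (\<exists>a b. (a, b, f) \<in> LTri P \<and> zero_object D (Dom D b)) \<and>
        (\<exists>b c. (f, b, c) \<in> RTri P \<and> zero_object D (Cod D b)) \<longrightarrow> is_iso D f)"

text \<open>As for \<^const>\<open>split_torsion_pair\<close>, the choice of adjoints is immaterial.\<close>

definition pretriangulated_torsion_pair ::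
  "('o, 'a, 'm) addcat_scheme \<Rightarrow> ('o, 'a) pretri \<Rightarrow> 'o set \<Rightarrow> 'o set \<Rightarrow> bool" where
  "pretriangulated_torsion_pair D P X Y \<longleftrightarrow>
     torsion_pair D X Y \<and>
     (\<forall>A\<in>X. FOb (Susp P) A \<in> X) \<and>
     (\<forall>\<tau> \<delta> \<sigma> \<eta>. inclusion_right_adjoint D X \<tau> \<delta> \<and> inclusion_left_adjoint D Y \<sigma> \<eta> \<longrightarrow>
        (\<forall>M\<in>Ob D.
           (\<exists>h. (\<delta> M, \<eta> M, h) \<in> RTri P) \<and>
           (\<exists>e. (e, \<delta> M, \<eta> M) \<in> LTri P)))"

end

theory Submission
  imports Defs
begin

text \<open>
  Being split only concerns the coreflections \<open>x \<rightarrow> M\<close> into the torsion class, which are unique up to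
  isomorphism. Everything is therefore argued with one chosen torsion sequence \<open>x \<rightarrow> M \<rightarrow> y\<close> for each
  object (\<open>torsion_theory\<close>), a notion that is stable under passing to the opposite category.

  Suppose that both pairs of a TTF triple \<open>(X, Y, Z)\<close> split. For \<open>M\<close> in \<open>X\<close>, the coreflection \<open>y \<rightarrow> M\<close>
  into \<open>Y\<close> has a retraction, which is zero as a morphism from \<open>X\<close> to \<open>Y\<close>; so \<open>y = 0\<close>, no nonzero morphism
  leads from \<open>Y\<close> to \<open>M\<close>, and \<open>M\<close> lies in \<open>Z\<close>. Dually \<open>Z\<close> is contained in \<open>X\<close>
  (\<open>split_TTF_outer_eq\<close>). Conversely, let \<open>X = Z\<close>. Then \<open>(X, Y)\<close> and \<open>(Y, X)\<close> are both torsion pairs,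
  and if one of them decomposes \<open>M\<close> as \<open>x \<oplus> y\<close>, the same decomposition splits the other one, because
  there are no nonzero morphisms between \<open>X\<close> and \<open>Y\<close> in either direction (\<open>split_flip\<close>).

  It remains to split \<open>(X, Y)\<close> when \<open>X = Z\<close>. The torsion sequences \<open>x \<rightarrow> M \<rightarrow> y\<close> for \<open>(X, Y)\<close> and
  \<open>y' \<rightarrow> M \<rightarrow> x'\<close> for \<open>(Y, X)\<close> give a comparison \<open>x \<rightarrow> M \<rightarrow> x'\<close>; once it is an isomorphism, \<open>x \<rightarrow> M\<close>
  is a section. In any additive category it is both a monomorphism and an epimorphism
  (\<open>comparison_mono\<close>, \<open>comparison_epi\<close>), and canonical factorizations make such morphisms invertible
  (\<open>mono_epi_iso\<close>). In the pretriangulated case the octahedral axiom exhibits its cone as an object of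
  both \<open>X\<close> and \<open>Y\<close>, which is zero (\<open>composite_cone_zero\<close>); the same argument in the opposite category
  handles the left triangle, and weak balancedness applies.
\<close>

section \<open>Additive categories and duality\<close>

locale additive =
  fixes D :: "('o, 'a, 'm) addcat_scheme" (structure)
  assumes additive: "additive_category D"
begin

lemma category: "is_category D"
  using additive by (simp add: additive_category_def)

lemma hom_Ob: "f \<in> Hom D A B \<Longrightarrow> A \<in> Ob D" "f \<in> Hom D A B \<Longrightarrow> B \<in> Ob D"
  using category unfolding is_category_def Hom_def by blast+

lemma hom_Arr: "f \<in> Hom D A B \<Longrightarrow> f \<in> Arr D" "f \<in> Hom D A B \<Longrightarrow> Dom D f = A"
    "f \<in> Hom D A B \<Longrightarrow> Cod D f = B"
  by (simp_all add: Hom_def)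

lemma ident_hom: "A \<in> Ob D \<Longrightarrow> Ident D A \<in> Hom D A A"
  using category unfolding is_category_def by blast

lemma comp_hom: "g \<in> Hom D B C \<Longrightarrow> f \<in> Hom D A B \<Longrightarrow> g \<cdot> f \<in> Hom D A C"
  using category unfolding is_category_def by blast

lemma comp_ident: "f \<in> Hom D A B \<Longrightarrow> f \<cdot> Ident D A = f"
  and ident_comp: "f \<in> Hom D A B \<Longrightarrow> Ident D B \<cdot> f = f"
  using category unfolding is_category_def by blast+

lemma comp_assoc:
  "h \<in> Hom D C E \<Longrightarrow> g \<in> Hom D B C \<Longrightarrow> f \<in> Hom D A B \<Longrightarrow> (h \<cdot> g) \<cdot> f = h \<cdot> (g \<cdot> f)"
  using category unfolding is_category_def by metis

lemma hom_comm_group: "A \<in> Ob D \<Longrightarrow> B \<in> Ob D \<Longrightarrow> comm_group (hom_group D A B)"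
  using additive unfolding additive_category_def by blast

lemma comp_plus:
  "f \<in> Hom D A B \<Longrightarrow> f' \<in> Hom D A B \<Longrightarrow> g \<in> Hom D B C \<Longrightarrow> g \<cdot> (f \<boxplus> f') = (g \<cdot> f) \<boxplus> (g \<cdot> f')"
  and plus_comp:
  "f \<in> Hom D A B \<Longrightarrow> h \<in> Hom D B C \<Longrightarrow> h' \<in> Hom D B C \<Longrightarrow> (h \<boxplus> h') \<cdot> f = (h \<cdot> f) \<boxplus> (h' \<cdot> f)"
  using additive unfolding additive_category_def by blast+

lemma zero_hom:
  assumes "A \<in> Ob D" "B \<in> Ob D"
  shows "Zer D A B \<in> Hom D A B"
proof -
  interpret G: comm_group "hom_group D A B" using assms by (rule hom_comm_group)
  show ?thesis using G.one_closed by (simp add: hom_group_def)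
qed

lemma zero_plus: "f \<in> Hom D A B \<Longrightarrow> Zer D A B \<boxplus> f = f"
  and plus_zero: "f \<in> Hom D A B \<Longrightarrow> f \<boxplus> Zer D A B = f"
proof -
  assume f: "f \<in> Hom D A B"
  interpret G: comm_group "hom_group D A B" using hom_Ob[OF f] by (rule hom_comm_group)
  show "Zer D A B \<boxplus> f = f" "f \<boxplus> Zer D A B = f"
    using f G.l_one[of f] G.r_one[of f] by (simp_all add: hom_group_def)
qed

lemma plus_right_eq_self:
  assumes "f \<in> Hom D A B" "g \<in> Hom D A B" "f \<boxplus> g = g"
  shows "f = Zer D A B"
proof -
  interpret G: comm_group "hom_group D A B" using hom_Ob[OF assms(1)] by (rule hom_comm_group)
  show ?thesis using assms G.l_cancel_one[of g f] G.r_cancel_one[of g f] by (simp add: hom_group_def)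
qed

lemma difference:
  assumes "u \<in> Hom D A B" "v \<in> Hom D A B"
  obtains w where "w \<in> Hom D A B" "w \<boxplus> v = u"
proof -
  interpret G: comm_group "hom_group D A B" using hom_Ob[OF assms(1)] by (rule hom_comm_group)
  let ?w = "u \<otimes>\<^bsub>hom_group D A B\<^esub> inv\<^bsub>hom_group D A B\<^esub> v"
  have c: "u \<in> carrier (hom_group D A B)" "v \<in> carrier (hom_group D A B)"
    using assms by (simp_all add: hom_group_def)
  have "?w \<in> carrier (hom_group D A B)" "?w \<otimes>\<^bsub>hom_group D A B\<^esub> v = u"
    using c by (simp_all add: G.m_assoc)
  then show thesis using that[of ?w] by (simp add: hom_group_def)
qed

lemma comp_zero:
  assumes g: "g \<in> Hom D B C" and A: "A \<in> Ob D"
  shows "g \<cdot> Zer D A B = Zer D A C"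
proof -
  have z: "Zer D A B \<in> Hom D A B" using A hom_Ob(1)[OF g] by (rule zero_hom)
  have "g \<cdot> Zer D A B = (g \<cdot> Zer D A B) \<boxplus> (g \<cdot> Zer D A B)"
    using comp_plus[OF z z g] zero_plus[OF z] by simp
  then show ?thesis using plus_right_eq_self comp_hom[OF g z] by metis
qed

lemma zero_comp:
  assumes f: "f \<in> Hom D A B" and C: "C \<in> Ob D"
  shows "Zer D B C \<cdot> f = Zer D A C"
proof -
  have z: "Zer D B C \<in> Hom D B C" using hom_Ob(2)[OF f] C by (rule zero_hom)
  have "Zer D B C \<cdot> f = (Zer D B C \<cdot> f) \<boxplus> (Zer D B C \<cdot> f)"
    using plus_comp[OF f z z] zero_plus[OF z] by simp
  then show ?thesis using plus_right_eq_self comp_hom[OF z f] by metis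
qed

lemma mono_if_kernel_zero:
  assumes f: "f \<in> Hom D A B"
    and ker: "\<And>T u. u \<in> Hom D T A \<Longrightarrow> f \<cdot> u = Zer D T B \<Longrightarrow> u = Zer D T A"
  shows "is_mono D f"
proof -
  have "u = v" if u: "u \<in> Hom D T A" and v: "v \<in> Hom D T A" and eq: "f \<cdot> u = f \<cdot> v" for T u v
  proof -
    obtain w where w: "w \<in> Hom D T A" "w \<boxplus> v = u" using difference[OF u v] .
    have "(f \<cdot> w) \<boxplus> (f \<cdot> v) = f \<cdot> v"
      using comp_plus[OF w(1) v f] w(2) eq by simp
    then have "f \<cdot> w = Zer D T B"
      using plus_right_eq_self comp_hom[OF f w(1)] comp_hom[OF f v] by blast
    then have "w = Zer D T A" using ker w(1) by blast
    then show "u = v" using w(2) zero_plus[OF v] by simp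
  qed
  then show ?thesis using f unfolding is_mono_def by (auto simp: Hom_def)
qed

lemma is_isoI:
  assumes "f \<in> Hom D A B" "g \<in> Hom D B A" "g \<cdot> f = Ident D A" "f \<cdot> g = Ident D B"
  shows "is_iso D f"
  using assms unfolding is_iso_def Hom_def by auto

lemma zero_object_if_ident_zero:
  assumes N: "N \<in> Ob D" and id: "Ident D N = Zer D N N"
  shows "zero_object D N"
proof -
  have "\<exists>!f. f \<in> Hom D A N" "\<exists>!f. f \<in> Hom D N A" if A: "A \<in> Ob D" for A
  proof -
    have "f = Zer D A N" if "f \<in> Hom D A N" for f
      using ident_comp[OF that] id zero_comp[OF that N] by simp
    then show "\<exists>!f. f \<in> Hom D A N" using zero_hom[OF A N] by blast
    have "f = Zer D N A" if "f \<in> Hom D N A" for f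
      using comp_ident[OF that] id comp_zero[OF that N] by simp
    then show "\<exists>!f. f \<in> Hom D N A" using zero_hom[OF N A] by blast
  qed
  then show ?thesis using N unfolding zero_object_def by blast
qed

lemma zero_object_exists: obtains N where "zero_object D N"
  using additive unfolding additive_category_def by blast

end

lemma opposite_simps [simp]:
  "Ob (opposite D) = Ob D" "Arr (opposite D) = Arr D"
  "Dom (opposite D) = Cod D" "Cod (opposite D) = Dom D"
  "Ident (opposite D) = Ident D" "Plus (opposite D) = Plus D"
  "Zer (opposite D) A B = Zer D B A"
  "Comp (opposite D) g f = Comp D f g"
  by (simp_all add: opposite_def)

lemma Hom_opposite [simp]: "Hom (opposite D) A B = Hom D B A"
  by (auto simp: Hom_def)

lemma hom_group_opposite: "hom_group (opposite D) A B = hom_group D B A"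
  by (simp add: hom_group_def)

lemma zero_object_opposite [simp]: "zero_object (opposite D) N = zero_object D N"
  by (auto simp: zero_object_def)

lemma is_mono_opposite [simp]: "is_mono (opposite D) f = is_epi D f"
  by (simp add: is_mono_def is_epi_def)

lemma weakly_exact_opposite: "weakly_exact D f g \<Longrightarrow> weakly_exact (opposite D) g f"
  by (simp add: weakly_exact_def)

lemma is_biproduct_opposite: "is_biproduct D A B S i j p q \<Longrightarrow> is_biproduct (opposite D) A B S p q i j"
  by (auto simp: is_biproduct_def)

context additive
begin

lemma category_opposite: "is_category (opposite D)"
proof -
  have "\<forall>f\<in>Arr D. Cod D f \<in> Ob D \<and> Dom D f \<in> Ob D"
    using category unfolding is_category_def by blast
  then show ?thesis
    unfolding is_category_def Hom_opposite opposite_simps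
    using ident_hom comp_hom comp_ident ident_comp comp_assoc by simp
qed

lemma additive_opposite: "additive_category (opposite D)"
proof -
  have zero: "\<exists>N. zero_object D N" using zero_object_exists by blast
  have "\<exists>S i j p q. is_biproduct (opposite D) A B S i j p q" if "A \<in> Ob D" "B \<in> Ob D" for A B
    using additive that is_biproduct_opposite[of D A B] unfolding additive_category_def by meson
  then show ?thesis
    unfolding additive_category_def Hom_opposite opposite_simps hom_group_opposite zero_object_opposite
    using category_opposite zero comp_plus plus_comp hom_comm_group by simp
qed

lemma additive_locale_opposite: "additive (opposite D)"
  by unfold_locales (rule additive_opposite)

end

lemma opposite_opposite [simp]: "opposite (opposite D) = D"
  by (cases D) (simp add: opposite_def)

lemma isomorphic_opposite:
  assumes "isomorphic (opposite D) A B"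
  shows "isomorphic D A B"
proof -
  obtain f where f: "f \<in> Hom D B A" "is_iso (opposite D) f"
    using assms by (auto simp: isomorphic_def)
  then obtain g where "g \<in> Hom D A B" "f \<cdot>\<^bsub>D\<^esub> g = Ident D A" "g \<cdot>\<^bsub>D\<^esub> f = Ident D B"
    by (auto simp: is_iso_def Hom_def)
  then have "is_iso D g" "g \<in> Hom D A B" using f(1) by (auto simp: is_iso_def Hom_def)
  then show ?thesis unfolding isomorphic_def by blast
qed

lemma strictly_full_opposite: "strictly_full D X \<Longrightarrow> strictly_full (opposite D) X"
  by (auto simp: strictly_full_def dest: isomorphic_opposite)


section \<open>Torsion pairs without adjoints\<close>

text \<open>The universal property of a counit \<open>\<delta> M\<close> of the inclusion of \<open>X\<close>, at a single object \<open>M\<close>. Reflections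
  are the coreflections of the opposite category.\<close>

definition coreflection :: "('o, 'a, 'm) addcat_scheme \<Rightarrow> 'o set \<Rightarrow> 'o \<Rightarrow> 'a \<Rightarrow> bool" where
  "coreflection D X M d \<longleftrightarrow>
     Dom D d \<in> X \<and> d \<in> Hom D (Dom D d) M \<and>
     (\<forall>A\<in>X. \<forall>g\<in>Hom D A M. \<exists>!u. u \<in> Hom D A (Dom D d) \<and> d \<cdot>\<^bsub>D\<^esub> u = g)"

definition torsion_sequence ::
  "('o, 'a, 'm) addcat_scheme \<Rightarrow> 'o set \<Rightarrow> 'o set \<Rightarrow> 'o \<Rightarrow> 'a \<Rightarrow> 'a \<Rightarrow> bool" where
  "torsion_sequence D X Y M d e \<longleftrightarrow>
     coreflection D X M d \<and> coreflection (opposite D) Y M e \<and> weakly_exact D d e"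

text \<open>Torsion sequences are chosen object by object instead of through adjoint functors, so that the notion
  is visibly self-dual, with the two classes exchanged.\<close>

definition torsion_theory :: "('o, 'a, 'm) addcat_scheme \<Rightarrow> 'o set \<Rightarrow> 'o set \<Rightarrow> bool" where
  "torsion_theory D X Y \<longleftrightarrow>
     strictly_full D X \<and> strictly_full D Y \<and>
     (\<forall>A\<in>X. \<forall>B\<in>Y. Hom D A B = {Zer D A B}) \<and>
     (\<forall>M\<in>Ob D. \<exists>d e. torsion_sequence D X Y M d e)"

lemma torsion_theory_opposite: "torsion_theory D X Y \<Longrightarrow> torsion_theory (opposite D) Y X"
  unfolding torsion_theory_def torsion_sequence_def
  using strictly_full_opposite weakly_exact_opposite by fastforce

context additive
begin

text \<open>The factorization of \<open>g : A \<rightarrow> M\<close> is its adjoint transpose \<open>\<tau> g \<cdot> \<eta> A\<close>.\<close>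

lemma right_adjoint_coreflection:
  assumes adj: "inclusion_right_adjoint D X \<tau> \<delta>" and M: "M \<in> Ob D"
  shows "coreflection D X M (\<delta> M)"
proof -
  obtain \<eta> where adj: "adjunction (full_sub D X) D functor_id \<tau> \<eta> \<delta>"
    using adj unfolding inclusion_right_adjoint_def by blast
  have sub_hom: "Hom (full_sub D X) A B = {f \<in> Hom D A B. A \<in> X \<and> B \<in> X}" for A B
    by (auto simp: full_sub_def Hom_def)
  have sub: "Ob (full_sub D X) = X" "Comp (full_sub D X) = Comp D" "Ident (full_sub D X) = Ident D"
    by (simp_all add: full_sub_def)
  note adj = adj[unfolded adjunction_def is_functor_def natural_transformation_def functor_id_def
      functor_comp_def sub sub_hom, simplified]
  have \<tau>X: "\<forall>A\<in>Ob D. FOb \<tau> A \<in> X" and XOb: "\<forall>A\<in>X. A \<in> Ob D"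
    using adj by - (elim conjE, assumption)+
  have \<tau>hom: "FArr \<tau> f \<in> Hom D (FOb \<tau> A) (FOb \<tau> B)" if "f \<in> Hom D A B" for f A B
    using adj that by - (elim conjE, blast)
  have \<tau>comp: "\<forall>A B E. \<forall>f\<in>Hom D A B. \<forall>g\<in>Hom D B E. FArr \<tau> (g \<cdot> f) = FArr \<tau> g \<cdot> FArr \<tau> f"
    and \<delta>hom: "\<forall>A\<in>Ob D. \<delta> A \<in> Hom D (FOb \<tau> A) A"
    and \<delta>nat: "\<forall>A B. \<forall>f\<in>Hom D A B. \<delta> B \<cdot> FArr \<tau> f = f \<cdot> \<delta> A"
    and \<eta>hom: "\<forall>A\<in>X. \<eta> A \<in> Hom D A (FOb \<tau> A) \<and> FOb \<tau> A \<in> X"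
    and \<eta>nat: "\<forall>A B f. f \<in> Hom D A B \<and> A \<in> X \<and> B \<in> X \<longrightarrow> \<eta> B \<cdot> f = FArr \<tau> f \<cdot> \<eta> A"
    and tri1: "\<forall>A\<in>X. \<delta> A \<cdot> \<eta> A = Ident D A"
    and tri2: "\<forall>B\<in>Ob D. FArr \<tau> (\<delta> B) \<cdot> \<eta> (FOb \<tau> B) = Ident D (FOb \<tau> B)"
    using adj by - (elim conjE, assumption)+
  note \<tau>X = \<tau>X[rule_format] and XOb = XOb[rule_format] and \<tau>comp = \<tau>comp[rule_format]
    and \<delta>hom = \<delta>hom[rule_format] and \<delta>nat = \<delta>nat[rule_format]
    and \<eta>hom = \<eta>hom[rule_format, THEN conjunct1] and tri1 = tri1[rule_format] and tri2 = tri2[rule_format]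
    and \<eta>nat = \<eta>nat[rule_format, OF conjI, OF _ conjI]
  have dom: "Dom D (\<delta> M) = FOb \<tau> M" using \<delta>hom[OF M] by (simp add: Hom_def)
  have "\<exists>!u. u \<in> Hom D A (FOb \<tau> M) \<and> \<delta> M \<cdot> u = g" if A: "A \<in> X" and g: "g \<in> Hom D A M" for A g
  proof (rule ex1I[of _ "FArr \<tau> g \<cdot> \<eta> A"])
    have "\<delta> M \<cdot> (FArr \<tau> g \<cdot> \<eta> A) = (\<delta> M \<cdot> FArr \<tau> g) \<cdot> \<eta> A"
      by (rule comp_assoc[OF \<delta>hom[OF M] \<tau>hom[OF g] \<eta>hom[OF A], symmetric])
    also have "\<dots> = g \<cdot> (\<delta> A \<cdot> \<eta> A)"
      using comp_assoc[OF g \<delta>hom[OF XOb[OF A]] \<eta>hom[OF A]] \<delta>nat[OF g] by simp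
    finally show "FArr \<tau> g \<cdot> \<eta> A \<in> Hom D A (FOb \<tau> M) \<and> \<delta> M \<cdot> (FArr \<tau> g \<cdot> \<eta> A) = g"
      using tri1[OF A] comp_ident[OF g] comp_hom[OF \<tau>hom[OF g] \<eta>hom[OF A]] by simp
  next
    fix u assume u: "u \<in> Hom D A (FOb \<tau> M) \<and> \<delta> M \<cdot> u = g"
    then have uh: "u \<in> Hom D A (FOb \<tau> M)" by blast
    let ?\<tau>M = "FOb \<tau> M"
    have "u = (FArr \<tau> (\<delta> M) \<cdot> \<eta> ?\<tau>M) \<cdot> u"
      using tri2[OF M] ident_comp[OF uh] by simp
    also have "\<dots> = FArr \<tau> (\<delta> M) \<cdot> (FArr \<tau> u \<cdot> \<eta> A)"
      using comp_assoc[OF \<tau>hom[OF \<delta>hom[OF M]] \<eta>hom[OF \<tau>X[OF M]] uh] \<eta>nat[OF uh A \<tau>X[OF M]] by simp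
    also have "\<dots> = FArr \<tau> g \<cdot> \<eta> A"
      using comp_assoc[OF \<tau>hom[OF \<delta>hom[OF M]] \<tau>hom[OF uh] \<eta>hom[OF A]]
        \<tau>comp[OF uh \<delta>hom[OF M]] u by simp
    finally show "u = FArr \<tau> g \<cdot> \<eta> A" .
  qed
  then show ?thesis
    unfolding coreflection_def dom using \<tau>X[OF M] \<delta>hom[OF M] by blast
qed

end

lemma adjunction_opposite:
  assumes "adjunction D (full_sub D Y) \<sigma> functor_id \<eta> \<delta>"
  shows "adjunction (full_sub (opposite D) Y) (opposite D) functor_id \<sigma> \<delta> \<eta>"
proof -
  let ?C = "full_sub (opposite D) Y" and ?C' = "full_sub D Y"
  have sub: "Hom ?C A B = Hom ?C' B A" "Ob ?C = Ob ?C'" "Comp ?C g f = Comp ?C' f g" "Ident ?C = Ident ?C'"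
    for A B f g
    by (auto simp: full_sub_def Hom_def)
  have a: "is_functor D ?C' \<sigma>" "is_functor ?C' D functor_id"
    "natural_transformation D D functor_id (functor_comp functor_id \<sigma>) \<eta>"
    "natural_transformation ?C' ?C' (functor_comp \<sigma> functor_id) functor_id \<delta>"
    using assms unfolding adjunction_def by - (elim conjE, assumption)+
  have "is_functor (opposite D) ?C \<sigma>" "is_functor ?C (opposite D) functor_id"
    using a(1,2) unfolding is_functor_def sub Hom_opposite opposite_simps by blast+
  moreover have "natural_transformation (opposite D) (opposite D) (functor_comp functor_id \<sigma>) functor_id \<eta>"
    using a(3) unfolding natural_transformation_def Hom_opposite opposite_simps by metis
  moreover have "natural_transformation ?C ?C functor_id (functor_comp \<sigma> functor_id) \<delta>"
    using a(4) unfolding natural_transformation_def sub by metis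
  ultimately show ?thesis
    using assms unfolding adjunction_def sub opposite_simps by (elim conjE, intro conjI)
qed

context additive
begin

lemma left_adjoint_reflection:
  assumes "inclusion_left_adjoint D Y \<sigma> \<eta>" and "M \<in> Ob D"
  shows "coreflection (opposite D) Y M (\<eta> M)"
proof -
  interpret op: additive "opposite D" by (rule additive_locale_opposite)
  show ?thesis
    using assms adjunction_opposite op.right_adjoint_coreflection
    unfolding inclusion_left_adjoint_def inclusion_right_adjoint_def by (metis opposite_simps(1))
qed

lemma adjoints_torsion_sequence:
  assumes "inclusion_right_adjoint D X \<tau> \<delta>" "inclusion_left_adjoint D Y \<sigma> \<eta>"
    and "M \<in> Ob D" "weakly_exact D (\<delta> M) (\<eta> M)"
  shows "torsion_sequence D X Y M (\<delta> M) (\<eta> M)"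
  using assms right_adjoint_coreflection left_adjoint_reflection
  unfolding torsion_sequence_def by blast

lemma torsion_pair_torsion_theory: "torsion_pair D X Y \<Longrightarrow> torsion_theory D X Y"
  unfolding torsion_pair_def torsion_theory_def
  using adjoints_torsion_sequence by blast

lemma coreflection_factor:
  assumes "coreflection D X M d" "g \<in> Hom D A M" "A \<in> X"
  obtains u where "u \<in> Hom D A (Dom D d)" "d \<cdot> u = g"
  using assms unfolding coreflection_def by blast

lemma coreflection_cancel:
  assumes "coreflection D X M d" "A \<in> X" "u \<in> Hom D A (Dom D d)" "v \<in> Hom D A (Dom D d)"
    and "d \<cdot> u = d \<cdot> v"
  shows "u = v"
  using assms comp_hom unfolding coreflection_def by metis

lemma coreflection_section_unique:
  assumes d: "coreflection D X M d" and d': "coreflection D X M d'" and s: "is_section D d"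
  shows "is_section D d'"
proof -
  have dh: "d \<in> Hom D (Dom D d) M" "Dom D d \<in> X" and d'h: "d' \<in> Hom D (Dom D d') M" "Dom D d' \<in> X"
    using d d' by (auto simp: coreflection_def)
  obtain u where u: "u \<in> Hom D (Dom D d) (Dom D d')" "d' \<cdot> u = d"
    using coreflection_factor[OF d' dh] .
  obtain v where v: "v \<in> Hom D (Dom D d') (Dom D d)" "d \<cdot> v = d'"
    using coreflection_factor[OF d d'h] .
  obtain r where r: "r \<in> Hom D M (Dom D d)" "r \<cdot> d = Ident D (Dom D d)"
    using s dh(1) unfolding is_section_def by (auto simp: Hom_def)
  have "r \<cdot> d' = v"
    using comp_assoc[OF r(1) dh(1) v(1)] r v ident_comp[OF v(1)] by simp
  then have "(u \<cdot> r) \<cdot> d' = u \<cdot> v" using comp_assoc[OF u(1) r(1) d'h(1)] by simp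
  also have "u \<cdot> v = Ident D (Dom D d')"
  proof (rule coreflection_cancel[OF d' d'h(2)])
    show "u \<cdot> v \<in> Hom D (Dom D d') (Dom D d')" using comp_hom[OF u(1) v(1)] .
    show "Ident D (Dom D d') \<in> Hom D (Dom D d') (Dom D d')"
      using ident_hom hom_Ob(1)[OF d'h(1)] by blast
    show "d' \<cdot> (u \<cdot> v) = d' \<cdot> Ident D (Dom D d')"
      using comp_assoc[OF d'h(1) u(1) v(1)] u v comp_ident[OF d'h(1)] by simp
  qed
  finally show ?thesis
    using comp_hom[OF u(1) r(1)] hom_Arr[OF d'h(1)] unfolding is_section_def by auto
qed

lemma split_torsion_pairI:
  assumes "torsion_pair D X Y"
    and "\<And>M. M \<in> Ob D \<Longrightarrow> \<exists>d. coreflection D X M d \<and> is_section D d"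
  shows "split_torsion_pair D X Y"
  using assms right_adjoint_coreflection coreflection_section_unique
  unfolding split_torsion_pair_def by blast

lemma split_torsion_pairD:
  assumes "split_torsion_pair D X Y" "coreflection D X M d"
  shows "is_section D d"
proof -
  have "M \<in> Ob D" using assms(2) hom_Ob by (auto simp: coreflection_def)
  moreover obtain \<tau> \<delta> where "inclusion_right_adjoint D X \<tau> \<delta>"
    using assms(1) unfolding split_torsion_pair_def torsion_pair_def by blast
  ultimately show ?thesis
    using assms right_adjoint_coreflection coreflection_section_unique
    unfolding split_torsion_pair_def by blast
qed

lemma weakly_exact_lift:
  assumes "weakly_exact D d e" "v \<in> Hom D T (Cod D d)" "e \<cdot> v = Zer D T (Cod D e)"
  obtains u where "u \<in> Hom D T (Dom D d)" "v = d \<cdot> u"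
proof -
  have "v \<in> {d \<cdot> u | u. u \<in> Hom D T (Dom D d)}"
    using assms hom_Ob(1)[OF assms(2)] unfolding weakly_exact_def by blast
  then show thesis using that by blast
qed

lemma weakly_exact_extend:
  assumes "weakly_exact D d e" "v \<in> Hom D (Dom D e) T" "v \<cdot> d = Zer D (Dom D d) T"
  obtains u where "u \<in> Hom D (Cod D e) T" "v = u \<cdot> e"
proof -
  have "v \<in> {u \<cdot> e | u. u \<in> Hom D (Cod D e) T}"
    using assms hom_Ob(2)[OF assms(2)] unfolding weakly_exact_def by blast
  then show thesis using that by blast
qed

lemma torsion_sequence_hom:
  assumes "torsion_sequence D X Y M d e"
  shows "d \<in> Hom D (Dom D d) M" "e \<in> Hom D M (Cod D e)" "Dom D d \<in> X" "Cod D e \<in> Y"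
  using assms by (auto simp: torsion_sequence_def coreflection_def)

lemma torsion_sequence_lift:
  assumes "torsion_sequence D X Y M d e" "v \<in> Hom D T M" "e \<cdot> v = Zer D T (Cod D e)"
  obtains u where "u \<in> Hom D T (Dom D d)" "v = d \<cdot> u"
  using weakly_exact_lift[of d e v T] assms torsion_sequence_hom[OF assms(1)] hom_Arr
  unfolding torsion_sequence_def by metis

lemma torsion_sequence_extend:
  assumes "torsion_sequence D X Y M d e" "v \<in> Hom D M T" "v \<cdot> d = Zer D (Dom D d) T"
  obtains u where "u \<in> Hom D (Cod D e) T" "v = u \<cdot> e"
  using weakly_exact_extend[of d e v T] assms torsion_sequence_hom[OF assms(1)] hom_Arr
  unfolding torsion_sequence_def by metis

lemma torsion_theory_zero:
  assumes "torsion_theory D X Y" "A \<in> X" "B \<in> Y" "f \<in> Hom D A B"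
  shows "f = Zer D A B"
  using assms unfolding torsion_theory_def by blast

text \<open>An object \<open>A\<close> without nonzero morphisms to \<open>Y\<close> has zero reflection, so by exactness its identity factors
  through the coreflection, which is then an isomorphism. This is how membership in a torsion
  class is always established below.\<close>

lemma torsion_class_perp:
  assumes tt: "torsion_theory D X Y" and A: "A \<in> Ob D"
    and perp: "\<And>B f. B \<in> Y \<Longrightarrow> f \<in> Hom D A B \<Longrightarrow> f = Zer D A B"
  shows "A \<in> X"
proof -
  obtain d e where s: "torsion_sequence D X Y A d e"
    using tt A unfolding torsion_theory_def by blast
  note h = torsion_sequence_hom[OF s]
  have co: "coreflection D X A d" using s by (simp add: torsion_sequence_def)
  have "e \<cdot> Ident D A = Zer D A (Cod D e)" using perp[OF h(4,2)] comp_ident[OF h(2)] by simp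
  then obtain u where u: "u \<in> Hom D A (Dom D d)" "Ident D A = d \<cdot> u"
    using torsion_sequence_lift[OF s ident_hom[OF A]] by blast
  have "u \<cdot> d = Ident D (Dom D d)"
  proof (rule coreflection_cancel[OF co h(3)])
    show "u \<cdot> d \<in> Hom D (Dom D d) (Dom D d)" using comp_hom[OF u(1) h(1)] .
    show "Ident D (Dom D d) \<in> Hom D (Dom D d) (Dom D d)" using ident_hom hom_Ob(1)[OF h(1)] by blast
    show "d \<cdot> (u \<cdot> d) = d \<cdot> Ident D (Dom D d)"
      using comp_assoc[OF h(1) u(1) h(1)] u(2) ident_comp[OF h(1)] comp_ident[OF h(1)] by simp
  qed
  then have "isomorphic D (Dom D d) A"
    using is_isoI[OF h(1) u(1)] u(2) h(1) unfolding isomorphic_def by auto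
  then show ?thesis using tt h(3) A unfolding torsion_theory_def strictly_full_def by blast
qed

lemma torsion_free_perp:
  assumes "torsion_theory D X Y" "B \<in> Ob D"
    and "\<And>A f. A \<in> X \<Longrightarrow> f \<in> Hom D A B \<Longrightarrow> f = Zer D A B"
  shows "B \<in> Y"
proof -
  interpret op: additive "opposite D" by (rule additive_locale_opposite)
  show ?thesis
    using op.torsion_class_perp[OF torsion_theory_opposite[OF assms(1)]] assms(2,3) by simp
qed


section \<open>Split torsion pairs\<close>

text \<open>If \<open>r\<close> is a retraction of \<open>d\<close>, then \<open>1 - d r\<close> kills \<open>d\<close> and hence factors through \<open>e\<close>; this is the
  decomposition of \<open>M\<close> into its torsion part and its torsion-free quotient.\<close>

lemma section_complement:
  assumes s: "torsion_sequence D X Y M d e" and r: "is_section D d"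
  obtains r t where "r \<in> Hom D M (Dom D d)" "r \<cdot> d = Ident D (Dom D d)" "t \<in> Hom D (Cod D e) M"
    "(t \<cdot> e) \<boxplus> (d \<cdot> r) = Ident D M"
proof -
  note h = torsion_sequence_hom[OF s]
  have M: "M \<in> Ob D" using hom_Ob(2)[OF h(1)] .
  obtain r where r: "r \<in> Hom D M (Dom D d)" "r \<cdot> d = Ident D (Dom D d)"
    using r h(1) unfolding is_section_def by (auto simp: Hom_def)
  have dr: "d \<cdot> r \<in> Hom D M M" using comp_hom[OF h(1) r(1)] .
  obtain w where w: "w \<in> Hom D M M" "w \<boxplus> (d \<cdot> r) = Ident D M"
    using difference[OF ident_hom[OF M] dr] .
  have "(w \<cdot> d) \<boxplus> d = d"
    using plus_comp[OF h(1) w(1) dr] w(2) comp_assoc[OF h(1) r(1) h(1)] r(2)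
      comp_ident[OF h(1)] ident_comp[OF h(1)] by simp
  then have "w \<cdot> d = Zer D (Dom D d) M"
    using plus_right_eq_self[OF comp_hom[OF w(1) h(1)] h(1)] by blast
  then obtain t where "t \<in> Hom D (Cod D e) M" "w = t \<cdot> e"
    using torsion_sequence_extend[OF s w(1)] by blast
  then show thesis using that r w(2) by blast
qed

text \<open>In the decomposition \<open>1 = t e + d r\<close> coming from \<open>(X, Y)\<close>, a morphism from \<open>Y\<close> to \<open>M\<close> is killed by \<open>r\<close> because \<open>(Y, X)\<close>
  is orthogonal as well. So it factors through \<open>t\<close>, which starts in \<open>Y\<close>: \<open>t\<close> is the coreflection into \<open>Y\<close> up
  to isomorphism, with retraction \<open>e\<close>.\<close>

lemma split_flip:
  assumes split: "split_torsion_pair D X Y" and tp: "torsion_pair D Y X"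
  shows "split_torsion_pair D Y X"
proof (rule split_torsion_pairI[OF tp])
  fix M assume M: "M \<in> Ob D"
  have XY: "torsion_theory D X Y" and YX: "torsion_theory D Y X"
    using split tp torsion_pair_torsion_theory unfolding split_torsion_pair_def by auto
  obtain d e where s: "torsion_sequence D X Y M d e" using XY M unfolding torsion_theory_def by blast
  obtain d' e' where s': "torsion_sequence D Y X M d' e'" using YX M unfolding torsion_theory_def by blast
  note h = torsion_sequence_hom[OF s] and h' = torsion_sequence_hom[OF s']
  have co': "coreflection D Y M d'" using s' by (simp add: torsion_sequence_def)
  have "is_section D d" using split_torsion_pairD[OF split] s unfolding torsion_sequence_def by blast
  then obtain r t where r: "r \<in> Hom D M (Dom D d)" and t: "t \<in> Hom D (Cod D e) M"
    and sum: "(t \<cdot> e) \<boxplus> (d \<cdot> r) = Ident D M"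
    using section_complement[OF s] by metis
  have te: "t \<cdot> e \<in> Hom D M M" and dr: "d \<cdot> r \<in> Hom D M M"
    using comp_hom[OF t h(2)] comp_hom[OF h(1) r] .
  let ?y = "Dom D d'"
  have y: "?y \<in> Ob D" using hom_Ob(1)[OF h'(1)] .
  have rd': "r \<cdot> d' = Zer D ?y (Dom D d)"
    using torsion_theory_zero[OF YX h'(3) h(3) comp_hom[OF r h'(1)]] .
  have "(d \<cdot> r) \<cdot> d' = Zer D ?y M"
    using comp_assoc[OF h(1) r h'(1)] rd' comp_zero[OF h(1) y] by simp
  then have fix_d': "(t \<cdot> e) \<cdot> d' = d'"
    using plus_comp[OF h'(1) te dr] sum ident_comp[OF h'(1)] plus_zero[OF comp_hom[OF te h'(1)]]
    by simp
  obtain q where q: "q \<in> Hom D (Cod D e) ?y" "d' \<cdot> q = t"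
    using coreflection_factor[OF co' t h(4)] .
  have qe: "q \<cdot> e \<in> Hom D M ?y" using comp_hom[OF q(1) h(2)] .
  \<comment> \<open>\<open>q : Cod e \<rightarrow> ?y\<close> is the inverse of \<open>e d'\<close>, so \<open>q e\<close> is the wanted retraction of \<open>d'\<close>\<close>
  have "(q \<cdot> e) \<cdot> d' = Ident D ?y"
  proof (rule coreflection_cancel[OF co' h'(3)])
    show "(q \<cdot> e) \<cdot> d' \<in> Hom D ?y ?y" using comp_hom[OF qe h'(1)] .
    show "Ident D ?y \<in> Hom D ?y ?y" using ident_hom[OF y] .
    have "d' \<cdot> ((q \<cdot> e) \<cdot> d') = (d' \<cdot> (q \<cdot> e)) \<cdot> d'"
      by (rule comp_assoc[OF h'(1) qe h'(1), symmetric])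
    also have "d' \<cdot> (q \<cdot> e) = t \<cdot> e" using comp_assoc[OF h'(1) q(1) h(2)] q(2) by simp
    finally show "d' \<cdot> ((q \<cdot> e) \<cdot> d') = d' \<cdot> Ident D ?y" using fix_d' comp_ident[OF h'(1)] by simp
  qed
  then have "is_section D d'" using qe hom_Arr[OF h'(1)] unfolding is_section_def by auto
  then show "\<exists>d. coreflection D Y M d \<and> is_section D d" using co' by blast
qed

text \<open>Each splitting provides a morphism against which orthogonality works: on an object of \<open>X\<close> the retraction
  of the coreflection into \<open>Y\<close> goes from \<open>X\<close> to \<open>Y\<close>, and on an object of \<open>Z\<close> the section of the reflection
  into \<open>Y\<close> goes from \<open>Y\<close> to \<open>Z\<close>. Both vanish, and with them the \<open>Y\<close>-part of the object.\<close>

lemma split_TTF_outer_eq: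
  assumes split: "split_torsion_pair D X Y" "split_torsion_pair D Y Z"
  shows "X = Z"
proof -
  have XY: "torsion_theory D X Y" and YZ: "torsion_theory D Y Z"
    using split torsion_pair_torsion_theory unfolding split_torsion_pair_def by auto
  show ?thesis
  proof (intro Set.set_eqI iffI)
    fix A assume A: "A \<in> X"
    then have AO: "A \<in> Ob D" using XY unfolding torsion_theory_def strictly_full_def by blast
    then obtain d e where s: "torsion_sequence D Y Z A d e" using YZ unfolding torsion_theory_def by blast
    note h = torsion_sequence_hom[OF s]
    have co: "coreflection D Y A d" using s by (simp add: torsion_sequence_def)
    obtain r where r: "r \<in> Hom D A (Dom D d)" "r \<cdot> d = Ident D (Dom D d)"
      using split_torsion_pairD[OF split(2) co] h(1) unfolding is_section_def by (auto simp: Hom_def)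
    have y: "Dom D d \<in> Ob D" using hom_Ob(1)[OF h(1)] .
    have "r = Zer D A (Dom D d)" using torsion_theory_zero[OF XY A h(3) r(1)] .
    then have "Ident D (Dom D d) = Zer D (Dom D d) (Dom D d)" using r(2) zero_comp[OF h(1) y] by simp
    then have d0: "d = Zer D (Dom D d) A" using comp_ident[OF h(1)] comp_zero[OF h(1) y] by simp
    show "A \<in> Z"
    proof (rule torsion_free_perp[OF YZ AO])
      fix B f assume B: "B \<in> Y" and f: "f \<in> Hom D B A"
      obtain u where u: "u \<in> Hom D B (Dom D d)" "d \<cdot> u = f" using coreflection_factor[OF co f B] .
      then show "f = Zer D B A" using d0 zero_comp[OF u(1) AO] by simp
    qed
  next
    fix B assume B: "B \<in> Z"
    then have BO: "B \<in> Ob D" using YZ unfolding torsion_theory_def strictly_full_def by blast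
    then obtain d e where s: "torsion_sequence D X Y B d e" using XY unfolding torsion_theory_def by blast
    note h = torsion_sequence_hom[OF s]
    have "is_section D d" using split_torsion_pairD[OF split(1)] s unfolding torsion_sequence_def by blast
    then obtain r t where r: "r \<in> Hom D B (Dom D d)" and t: "t \<in> Hom D (Cod D e) B"
      and sum: "(t \<cdot> e) \<boxplus> (d \<cdot> r) = Ident D B"
      using section_complement[OF s] by metis
    have "t \<cdot> e = Zer D B B"
      using torsion_theory_zero[OF YZ h(4) B t] zero_comp[OF h(2) BO] by simp
    then have dr: "d \<cdot> r = Ident D B" using sum zero_plus[OF comp_hom[OF h(1) r]] by simp
    show "B \<in> X"
    proof (rule torsion_class_perp[OF XY BO])
      fix C f assume C: "C \<in> Y" and f: "f \<in> Hom D B C"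
      have "f \<cdot> d = Zer D (Dom D d) C" using torsion_theory_zero[OF XY h(3) C comp_hom[OF f h(1)]] .
      then show "f = Zer D B C"
        using comp_assoc[OF f h(1) r] dr comp_ident[OF f] zero_comp[OF r hom_Ob(2)[OF f]] by simp
    qed
  qed
qed


section \<open>The comparison morphism between torsion part and torsion-free quotient\<close>

text \<open>Let \<open>u : T \<rightarrow> Dom d\<close> be killed by the comparison, so \<open>d u\<close> also comes from the \<open>Y\<close>-part \<open>d'\<close>. Restricted to the
  \<open>X\<close>-part \<open>a\<close> of \<open>T\<close> it vanishes, as \<open>X\<close> has no morphisms to \<open>Y\<close>, and \<open>d\<close> can be cancelled there. Hence
  \<open>u\<close> factors through the \<open>Y\<close>-quotient \<open>b\<close> of \<open>T\<close>, and there are no nonzero morphisms from \<open>Y\<close> to \<open>X\<close>.\<close>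

lemma comparison_mono:
  assumes XY: "torsion_theory D X Y" and YX: "torsion_theory D Y X"
    and s: "torsion_sequence D X Y M d e" and s': "torsion_sequence D Y X M d' e'"
  shows "is_mono D (e' \<cdot> d)"
proof (rule mono_if_kernel_zero)
  note h = torsion_sequence_hom[OF s] and h' = torsion_sequence_hom[OF s']
  have co: "coreflection D X M d" using s by (simp add: torsion_sequence_def)
  show "e' \<cdot> d \<in> Hom D (Dom D d) (Cod D e')" using comp_hom[OF h'(2) h(1)] .
  fix T u assume u: "u \<in> Hom D T (Dom D d)" and z: "(e' \<cdot> d) \<cdot> u = Zer D T (Cod D e')"
  have T: "T \<in> Ob D" using hom_Ob(1)[OF u] .
  obtain v where v: "v \<in> Hom D T (Dom D d')" "d \<cdot> u = d' \<cdot> v"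
    using torsion_sequence_lift[OF s' comp_hom[OF h(1) u]] comp_assoc[OF h'(2) h(1) u] z by metis
  obtain a b where ab: "torsion_sequence D X Y T a b" using XY T unfolding torsion_theory_def by blast
  note k = torsion_sequence_hom[OF ab]
  let ?a = "Dom D a"
  have a: "?a \<in> Ob D" using hom_Ob(1)[OF k(1)] .
  have va: "v \<cdot> a = Zer D ?a (Dom D d')"
    using torsion_theory_zero[OF XY k(3) h'(3) comp_hom[OF v(1) k(1)]] .
  have "d \<cdot> (u \<cdot> a) = d' \<cdot> (v \<cdot> a)"
    using comp_assoc[OF h(1) u k(1)] comp_assoc[OF h'(1) v(1) k(1)] v(2) by simp
  also have "\<dots> = d \<cdot> Zer D ?a (Dom D d)"
    using va comp_zero[OF h'(1) a] comp_zero[OF h(1) a] by simp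
  finally have "u \<cdot> a = Zer D ?a (Dom D d)"
    using coreflection_cancel[OF co k(3) comp_hom[OF u k(1)] zero_hom[OF a hom_Ob(1)[OF h(1)]]] by blast
  then obtain w where w: "w \<in> Hom D (Cod D b) (Dom D d)" "u = w \<cdot> b"
    using torsion_sequence_extend[OF ab u] by blast
  show "u = Zer D T (Dom D d)"
    using torsion_theory_zero[OF YX k(4) h(3) w(1)] w(2) zero_comp[OF k(2) hom_Ob(1)[OF h(1)]] by simp
qed

lemma comparison_epi:
  assumes "torsion_theory D X Y" "torsion_theory D Y X"
    and "torsion_sequence D X Y M d e" "torsion_sequence D Y X M d' e'"
  shows "is_epi D (e' \<cdot> d)"
proof -
  interpret op: additive "opposite D" by (rule additive_locale_opposite)
  have "torsion_sequence (opposite D) X Y M e' d'" "torsion_sequence (opposite D) Y X M e d"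
    using assms(3,4) weakly_exact_opposite unfolding torsion_sequence_def by auto
  then show ?thesis
    using op.comparison_mono[OF torsion_theory_opposite[OF assms(2)] torsion_theory_opposite[OF assms(1)]]
    by simp
qed

lemma section_if_comparison_iso:
  assumes s: "torsion_sequence D X Y M d e" and s': "torsion_sequence D Y X M d' e'"
    and iso: "is_iso D (e' \<cdot> d)"
  shows "is_section D d"
proof -
  note h = torsion_sequence_hom[OF s] and h' = torsion_sequence_hom[OF s']
  have c: "e' \<cdot> d \<in> Hom D (Dom D d) (Cod D e')" using comp_hom[OF h'(2) h(1)] .
  obtain g where g: "g \<in> Hom D (Cod D e') (Dom D d)" "g \<cdot> (e' \<cdot> d) = Ident D (Dom D d)"
    using iso unfolding is_iso_def hom_Arr(2,3)[OF c] by blast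
  then show ?thesis
    using comp_assoc[OF g(1) h'(2) h(1)] comp_hom[OF g(1) h'(2)] hom_Arr[OF h(1)]
    unfolding is_section_def by auto
qed

text \<open>Such an \<open>f\<close> has the two factorizations \<open>1 f\<close> and \<open>f 1\<close>; the morphism relating them is its inverse.\<close>

lemma mono_epi_iso:
  assumes can: "canonical_factorizations D" and f: "is_mono D f" "is_epi D f"
  shows "is_iso D f"
proof -
  have fh: "f \<in> Hom D (Dom D f) (Cod D f)" using f(1) by (simp add: is_mono_def Hom_def)
  let ?A = "Dom D f" and ?B = "Cod D f"
  have A: "Ident D ?A \<in> Hom D ?A ?A" and B: "Ident D ?B \<in> Hom D ?B ?B"
    using ident_hom hom_Ob[OF fh] by blast+
  have "is_epi D (Ident D ?A)" "is_mono D (Ident D ?B)"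
    unfolding is_epi_def is_mono_def hom_Arr[OF A] hom_Arr[OF B]
    using hom_Arr(1)[OF A] hom_Arr(1)[OF B] comp_ident ident_comp by metis+
  then have "epi_mono_factorization D f f (Ident D ?B)" "epi_mono_factorization D f (Ident D ?A) f"
    using f A B comp_ident[OF fh] ident_comp[OF fh] hom_Arr(2,3)[OF A] hom_Arr(2,3)[OF B]
    unfolding epi_mono_factorization_def by auto
  then obtain g where g: "g \<in> Hom D ?B ?A" "g \<cdot> f = Ident D ?A" "f \<cdot> g = Ident D ?B"
    using can f(1) hom_Arr(3)[OF A] unfolding canonical_factorizations_def is_mono_def by metis
  then show ?thesis using is_isoI[OF fh] by blast
qed


section \<open>Cones in right triangulated categories\<close>

context
  fixes S :: "('o, 'a, 'o, 'a) cat_functor" and \<T> :: "('a \<times> 'a \<times> 'a) set"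
  assumes rt: "right_triangulated D S \<T>"
begin

lemma right_triangulated_axioms:
  shows "\<forall>f g h. (f, g, h) \<in> \<T> \<longrightarrow> right_diagram D S f g h"
    and "\<forall>N M. zero_object D N \<and> M \<in> Ob D \<longrightarrow> (Zer D N M, Ident D M, Zer D M (FOb S N)) \<in> \<T>"
    and "\<forall>f g h. (f, g, h) \<in> \<T> \<longrightarrow> (g, h, Neg D (FArr S f)) \<in> \<T>"
    and "\<forall>f g h f' g' h' l m.
        (f, g, h) \<in> \<T> \<and> (f', g', h') \<in> \<T> \<and>
        l \<in> Hom D (Dom D f) (Dom D f') \<and> m \<in> Hom D (Cod D f) (Cod D f') \<and> m \<cdot> f = f' \<cdot> l \<longrightarrow>
        (\<exists>n. right_morphism D S (f, g, h) (f', g', h') l m n)"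
    and "\<forall>L M N. \<forall>f\<in>Hom D L M. \<forall>g\<in>Hom D M N.
        \<exists>m a p q r l u v.
          (f, m, a) \<in> \<T> \<and> (g \<cdot> f, p, q) \<in> \<T> \<and> (g, r, l) \<in> \<T> \<and> (u, v, FArr S m \<cdot> l) \<in> \<T> \<and>
          u \<in> Hom D (Cod D m) (Cod D p) \<and> v \<in> Hom D (Cod D p) (Cod D r) \<and>
          u \<cdot> m = p \<cdot> g \<and> q \<cdot> u = a \<and> v \<cdot> p = r \<and> l \<cdot> v = FArr S f \<cdot> q"
    and "additive_endofunctor D S"
  using rt unfolding right_triangulated_def by - (elim conjE, assumption)+

lemma right_triangle_hom:
  assumes "(f, g, h) \<in> \<T>"
  shows "f \<in> Hom D (Dom D f) (Cod D f)" "g \<in> Hom D (Cod D f) (Cod D g)"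
    "h \<in> Hom D (Cod D g) (FOb S (Dom D f))"
  using right_triangulated_axioms(1) assms by (auto simp: right_diagram_def Hom_def)

lemma right_triangle_rotate: "(f, g, h) \<in> \<T> \<Longrightarrow> (g, h, Neg D (FArr S f)) \<in> \<T>"
  using right_triangulated_axioms(3) by blast

lemma right_triangle_complete:
  assumes "(f, g, h) \<in> \<T>" "(f', g', h') \<in> \<T>"
    and "l \<in> Hom D (Dom D f) (Dom D f')" "m \<in> Hom D (Cod D f) (Cod D f')" "m \<cdot> f = f' \<cdot> l"
  obtains n where "n \<in> Hom D (Cod D g) (Cod D g')" "n \<cdot> g = g' \<cdot> m" "FArr S l \<cdot> h = h' \<cdot> n"
proof -
  have "\<exists>n. right_morphism D S (f, g, h) (f', g', h') l m n"
    using right_triangulated_axioms(4) assms by blast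
  then show thesis using that by (auto simp: right_morphism_def)
qed

text \<open>The cone is a weak cokernel: complete \<open>m\<close> to a morphism from the given triangle to the trivial triangle
  \<open>0 \<rightarrow> C \<rightarrow> C \<rightarrow> S 0\<close>.\<close>

lemma right_triangle_extend:
  assumes t: "(f, g, h) \<in> \<T>" and m: "m \<in> Hom D (Cod D f) C" "m \<cdot> f = Zer D (Dom D f) C"
  obtains w where "w \<in> Hom D (Cod D g) C" "m = w \<cdot> g"
proof -
  have C: "C \<in> Ob D" using hom_Ob(2)[OF m(1)] .
  obtain N where N: "zero_object D N" using zero_object_exists .
  then have NO: "N \<in> Ob D" by (simp add: zero_object_def)
  have L: "Dom D f \<in> Ob D" using hom_Ob(1)[OF right_triangle_hom(1)[OF t]] .
  have t': "(Zer D N C, Ident D C, Zer D C (FOb S N)) \<in> \<T>"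
    using right_triangulated_axioms(2) N C by blast
  have z: "Zer D N C \<in> Hom D N C" and i: "Ident D C \<in> Hom D C C" and z': "Zer D (Dom D f) N \<in> Hom D (Dom D f) N"
    using zero_hom[OF NO C] ident_hom[OF C] zero_hom[OF L NO] .
  obtain w where "w \<in> Hom D (Cod D g) C" "w \<cdot> g = Ident D C \<cdot> m"
    using right_triangle_complete[OF t t', of "Zer D (Dom D f) N" m]
      hom_Arr[OF z] hom_Arr[OF i] z' m zero_comp[OF z' C] by metis
  then show thesis using that ident_comp[OF m(1)] by simp
qed

lemma right_triangle_hom_zero:
  assumes t: "(f, g, h) \<in> \<T>"
    and M: "\<And>m. m \<in> Hom D (Cod D f) C \<Longrightarrow> m = Zer D (Cod D f) C"
    and SL: "\<And>m. m \<in> Hom D (FOb S (Dom D f)) C \<Longrightarrow> m = Zer D (FOb S (Dom D f)) C"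
    and n: "n \<in> Hom D (Cod D g) C"
  shows "n = Zer D (Cod D g) C"
proof -
  note h = right_triangle_hom[OF t]
  have C: "C \<in> Ob D" using hom_Ob(2)[OF n] .
  have gc: "Dom D g = Cod D f" "Cod D h = FOb S (Dom D f)" using hom_Arr h by blast+
  have "n \<cdot> g = Zer D (Dom D g) C" using M comp_hom[OF n h(2)] gc by simp
  then obtain w where w: "w \<in> Hom D (Cod D h) C" "n = w \<cdot> h"
    using right_triangle_extend[OF right_triangle_rotate[OF t] n] by blast
  then show ?thesis using SL gc zero_comp[OF h(3) C] by simp
qed

text \<open>The octahedral axiom supplies its own cones, so vanishing has to be transported between two cones of the
  same \<open>f\<close>. The comparison morphisms \<open>p\<close> and \<open>q\<close> over the identities satisfy \<open>q p g = g\<close> and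
  \<open>h q p = h\<close>. From \<open>u q = 0\<close> follows \<open>u g = 0\<close>, so \<open>u = w h\<close>, and then \<open>u = w h q p = u q p = 0\<close>.\<close>

lemma cone_hom_zero:
  assumes t: "(f, g, h) \<in> \<T>" and t': "(f, g', h') \<in> \<T>"
    and zero: "\<And>v. v \<in> Hom D (Cod D g') C \<Longrightarrow> v = Zer D (Cod D g') C"
    and u: "u \<in> Hom D (Cod D g) C"
  shows "u = Zer D (Cod D g) C"
proof -
  note h = right_triangle_hom[OF t] and h' = right_triangle_hom[OF t']
  have C: "C \<in> Ob D" using hom_Ob(2)[OF u] .
  let ?L = "Dom D f" and ?M = "Cod D f"
  have L: "Ident D ?L \<in> Hom D ?L ?L" and M: "Ident D ?M \<in> Hom D ?M ?M"
    using ident_hom hom_Ob[OF h(1)] by blast+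
  have eq: "Ident D ?M \<cdot> f = f \<cdot> Ident D ?L" using comp_ident[OF h(1)] ident_comp[OF h(1)] by simp
  have S1: "FArr S (Ident D ?L) = Ident D (FOb S ?L)"
    using right_triangulated_axioms(6) hom_Ob(1)[OF h(1)]
    unfolding additive_endofunctor_def is_functor_def by blast
  obtain p where p: "p \<in> Hom D (Cod D g) (Cod D g')" "p \<cdot> g = g' \<cdot> Ident D ?M"
      "FArr S (Ident D ?L) \<cdot> h = h' \<cdot> p"
    using right_triangle_complete[OF t t' L M eq] .
  obtain q where q: "q \<in> Hom D (Cod D g') (Cod D g)" "q \<cdot> g' = g \<cdot> Ident D ?M"
      "FArr S (Ident D ?L) \<cdot> h' = h \<cdot> q"
    using right_triangle_complete[OF t' t L M eq] .
  have uq: "u \<cdot> q = Zer D (Cod D g') C" using zero comp_hom[OF u q(1)] by blast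
  have g: "g = q \<cdot> g'" using q(2) comp_ident[OF h(2)] by simp
  have "u \<cdot> g = Zer D (Dom D g) C"
    using g comp_assoc[OF u q(1) h'(2)] uq zero_comp[OF h'(2) C] hom_Arr(2)[OF h(2)] by simp
  then obtain w where w: "w \<in> Hom D (Cod D h) C" "u = w \<cdot> h"
    using right_triangle_extend[OF right_triangle_rotate[OF t] u] by blast
  have w': "w \<in> Hom D (FOb S ?L) C" using w(1) hom_Arr(3)[OF h(3)] by simp
  have "h = h' \<cdot> p" using p(3) S1 ident_comp[OF h(3)] by simp
  also have "\<dots> = (h \<cdot> q) \<cdot> p" using q(3) S1 ident_comp[OF h'(3)] by simp
  also have "\<dots> = h \<cdot> (q \<cdot> p)" using comp_assoc[OF h(3) q(1) p(1)] .
  finally have "u = (w \<cdot> h) \<cdot> (q \<cdot> p)"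
    using w(2) comp_assoc[OF w' h(3) comp_hom[OF q(1) p(1)]] by simp
  also have "\<dots> = (u \<cdot> q) \<cdot> p" using w(2) comp_assoc[OF u q(1) p(1)] by simp
  finally show ?thesis using uq zero_comp[OF p(1) C] by simp
qed

text \<open>The cone of \<open>g f\<close> is built from \<open>N\<close> and \<open>S L\<close>, both in \<open>X\<close>, and, by the octahedral axiom, also from the
  cones of \<open>f\<close> and \<open>g\<close>, both in \<open>Y\<close>. Each class is closed under such extensions, being the class of objects
  without nonzero morphisms to the other one, and an object of both classes is zero. All hypotheses
  are symmetric under duality, so that the lemma also applies to left triangles.\<close>

lemma composite_cone_zero:
  assumes XY: "torsion_theory D X Y" and YX: "torsion_theory D Y X"
    and SX: "\<And>A. A \<in> X \<Longrightarrow> FOb S A \<in> X" and SY: "\<And>A. A \<in> Y \<Longrightarrow> FOb S A \<in> Y"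
    and f: "f \<in> Hom D L M" "L \<in> X" and g: "g \<in> Hom D M N" "N \<in> X"
    and t: "(f, f1, f2) \<in> \<T>" "Cod D f1 \<in> Y" and t': "(g, g1, g2) \<in> \<T>" "Cod D g1 \<in> Y"
  shows "\<exists>b c. (g \<cdot> f, b, c) \<in> \<T> \<and> zero_object D (Cod D b)"
proof -
  obtain m a p q r l u v where oct: "(f, m, a) \<in> \<T>" "(g \<cdot> f, p, q) \<in> \<T>" "(g, r, l) \<in> \<T>"
    "(u, v, FArr S m \<cdot> l) \<in> \<T>" "u \<in> Hom D (Cod D m) (Cod D p)" "v \<in> Hom D (Cod D p) (Cod D r)"
    using right_triangulated_axioms(5)[rule_format, OF f(1) g(1)] by blast
  let ?C = "Cod D p"
  have gf: "g \<cdot> f \<in> Hom D L N" using comp_hom[OF g(1) f(1)] .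
  have C: "?C \<in> Ob D" using hom_Ob(2)[OF right_triangle_hom(2)[OF oct(2)]] .
  have CX: "?C \<in> X"
  proof (rule torsion_class_perp[OF XY C])
    fix B k assume B: "B \<in> Y" and k: "k \<in> Hom D ?C B"
    show "k = Zer D ?C B"
      using right_triangle_hom_zero[OF oct(2) _ _ k] torsion_theory_zero[OF XY _ B] hom_Arr[OF gf]
        SX[OF f(2)] g(2) by metis
  qed
  have CY: "?C \<in> Y"
  proof (rule torsion_class_perp[OF YX C])
    fix B k assume B: "B \<in> X" and k: "k \<in> Hom D ?C B"
    have m0: "j = Zer D (Cod D m) B" if "j \<in> Hom D (Cod D m) B" for j
      using cone_hom_zero[OF oct(1) t(1) _ that] torsion_theory_zero[OF YX t(2) B] by blast
    have r0: "j = Zer D (Cod D r) B" if "j \<in> Hom D (Cod D r) B" for j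
      using cone_hom_zero[OF oct(3) t'(1) _ that] torsion_theory_zero[OF YX t'(2) B] by blast
    have "k \<cdot> u = Zer D (Dom D u) B" using m0 comp_hom[OF k oct(5)] hom_Arr(2)[OF oct(5)] by simp
    then obtain w where w: "w \<in> Hom D (Cod D v) B" "k = w \<cdot> v"
      using right_triangle_extend[OF oct(4)] k hom_Arr(3)[OF oct(5)] by metis
    then show "k = Zer D ?C B"
      using r0 hom_Arr(3)[OF oct(6)] zero_comp[OF oct(6) hom_Ob(2)[OF k]] by simp
  qed
  have "zero_object D ?C"
    using zero_object_if_ident_zero[OF C] torsion_theory_zero[OF XY CX CY ident_hom[OF C]] .
  then show ?thesis using oct(2) by blast
qed

end


section \<open>Splitting by inverting the comparison morphism\<close>

text \<open>A morphism \<open>A \<rightarrow> \<Omega> B\<close> is determined by its transpose \<open>\<Sigma> A \<rightarrow> B\<close>, which is zero by orthogonality.\<close>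

lemma loop_closed:
  assumes adj: "adjunction D D \<Sigma> \<Omega> \<eta> \<epsilon>" and XY: "torsion_theory D X Y"
    and S: "\<And>A. A \<in> X \<Longrightarrow> FOb \<Sigma> A \<in> X" and B: "B \<in> Y"
  shows "FOb \<Omega> B \<in> Y"
proof -
  note adj = adj[unfolded adjunction_def is_functor_def natural_transformation_def functor_id_def
      functor_comp_def, simplified]
  have \<Sigma>hom: "\<forall>A B. \<forall>f\<in>Hom D A B. FArr \<Sigma> f \<in> Hom D (FOb \<Sigma> A) (FOb \<Sigma> B)"
    and \<Omega>ob: "\<forall>A\<in>Ob D. FOb \<Omega> A \<in> Ob D"
    and \<Omega>hom: "\<forall>A B. \<forall>f\<in>Hom D A B. FArr \<Omega> f \<in> Hom D (FOb \<Omega> A) (FOb \<Omega> B)"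
    and \<Omega>comp: "\<forall>A B E. \<forall>f\<in>Hom D A B. \<forall>g\<in>Hom D B E. FArr \<Omega> (g \<cdot> f) = FArr \<Omega> g \<cdot> FArr \<Omega> f"
    and \<eta>hom: "\<forall>A\<in>Ob D. \<eta> A \<in> Hom D A (FOb \<Omega> (FOb \<Sigma> A))"
    and \<eta>nat: "\<forall>A B. \<forall>f\<in>Hom D A B. \<eta> B \<cdot> f = FArr \<Omega> (FArr \<Sigma> f) \<cdot> \<eta> A"
    and \<epsilon>hom: "\<forall>A\<in>Ob D. \<epsilon> A \<in> Hom D (FOb \<Sigma> (FOb \<Omega> A)) A"
    and triangle: "\<forall>B\<in>Ob D. FArr \<Omega> (\<epsilon> B) \<cdot> \<eta> (FOb \<Omega> B) = Ident D (FOb \<Omega> B)"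
    using adj by - (elim conjE, assumption)+
  have BO: "B \<in> Ob D" using XY B unfolding torsion_theory_def strictly_full_def by blast
  then have WB: "FOb \<Omega> B \<in> Ob D" using \<Omega>ob by blast
  show ?thesis
  proof (rule torsion_free_perp[OF XY WB])
    have \<epsilon>: "\<epsilon> B \<in> Hom D (FOb \<Sigma> (FOb \<Omega> B)) B" and \<eta>: "\<eta> (FOb \<Omega> B) \<in> Hom D (FOb \<Omega> B) (FOb \<Omega> (FOb \<Sigma> (FOb \<Omega> B)))"
      using \<epsilon>hom \<eta>hom BO WB by blast+
    have \<Omega>\<epsilon>: "FArr \<Omega> (\<epsilon> B) \<in> Hom D (FOb \<Omega> (FOb \<Sigma> (FOb \<Omega> B))) (FOb \<Omega> B)" using \<Omega>hom \<epsilon> by blast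
    fix A f assume A: "A \<in> X" and f: "f \<in> Hom D A (FOb \<Omega> B)"
    have transpose: "k = FArr \<Omega> (\<epsilon> B \<cdot> FArr \<Sigma> k) \<cdot> \<eta> A" if k: "k \<in> Hom D A (FOb \<Omega> B)" for k
    proof -
      have Sk: "FArr \<Sigma> k \<in> Hom D (FOb \<Sigma> A) (FOb \<Sigma> (FOb \<Omega> B))" using \<Sigma>hom k by blast
      then have WSk: "FArr \<Omega> (FArr \<Sigma> k) \<in> Hom D (FOb \<Omega> (FOb \<Sigma> A)) (FOb \<Omega> (FOb \<Sigma> (FOb \<Omega> B)))"
        using \<Omega>hom by blast
      have \<eta>A: "\<eta> A \<in> Hom D A (FOb \<Omega> (FOb \<Sigma> A))" using \<eta>hom hom_Ob(1)[OF k] by blast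
      have "k = (FArr \<Omega> (\<epsilon> B) \<cdot> \<eta> (FOb \<Omega> B)) \<cdot> k" using triangle BO ident_comp[OF k] by simp
      also have "\<dots> = FArr \<Omega> (\<epsilon> B) \<cdot> (\<eta> (FOb \<Omega> B) \<cdot> k)" using comp_assoc[OF \<Omega>\<epsilon> \<eta> k] .
      also have "\<eta> (FOb \<Omega> B) \<cdot> k = FArr \<Omega> (FArr \<Sigma> k) \<cdot> \<eta> A" using \<eta>nat k by blast
      also have "FArr \<Omega> (\<epsilon> B) \<cdot> (FArr \<Omega> (FArr \<Sigma> k) \<cdot> \<eta> A) = (FArr \<Omega> (\<epsilon> B) \<cdot> FArr \<Omega> (FArr \<Sigma> k)) \<cdot> \<eta> A"
        using comp_assoc[OF \<Omega>\<epsilon> WSk \<eta>A] by simp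
      also have "FArr \<Omega> (\<epsilon> B) \<cdot> FArr \<Omega> (FArr \<Sigma> k) = FArr \<Omega> (\<epsilon> B \<cdot> FArr \<Sigma> k)"
        using \<Omega>comp Sk \<epsilon> by metis
      finally show ?thesis .
    qed
    have zero: "\<epsilon> B \<cdot> FArr \<Sigma> k = Zer D (FOb \<Sigma> A) B" if k: "k \<in> Hom D A (FOb \<Omega> B)" for k
    proof -
      have "FArr \<Sigma> k \<in> Hom D (FOb \<Sigma> A) (FOb \<Sigma> (FOb \<Omega> B))" using \<Sigma>hom k by blast
      then show ?thesis using torsion_theory_zero[OF XY S[OF A] B comp_hom[OF \<epsilon>]] by blast
    qed
    have z: "Zer D A (FOb \<Omega> B) \<in> Hom D A (FOb \<Omega> B)" using zero_hom[OF hom_Ob[OF f]] .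
    show "f = Zer D A (FOb \<Omega> B)"
      using transpose[OF f] transpose[OF z] zero[OF f] zero[OF z] by simp
  qed
qed

text \<open>The morphism \<open>d\<close> has a cone in \<open>Y\<close>, namely the end of its torsion sequence, and rotation gives \<open>e'\<close> the cone
  \<open>\<Sigma> (Dom d')\<close>, in \<open>Y\<close> too. In the opposite category the roles are exchanged: \<open>e'\<close> has the cocone \<open>Dom d'\<close>
  and \<open>d\<close> the cocone \<open>\<Omega> (Cod e)\<close>.\<close>

lemma pretriangulated_comparison_iso:
  assumes pre: "pretriangulated D P" and bal: "weakly_balanced D P"
    and XY: "torsion_theory D X Y" and YX: "torsion_theory D Y X"
    and SX: "\<And>A. A \<in> X \<Longrightarrow> FOb (Susp P) A \<in> X" and SY: "\<And>A. A \<in> Y \<Longrightarrow> FOb (Susp P) A \<in> Y"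
    and s: "torsion_sequence D X Y M d e" and s': "torsion_sequence D Y X M d' e'"
    and R: "(d, e, h) \<in> RTri P" and R': "(d', e', h') \<in> RTri P"
    and L: "(k, d, e) \<in> LTri P" and L': "(k', d', e') \<in> LTri P"
  shows "is_iso D (e' \<cdot> d)"
proof -
  note hm = torsion_sequence_hom[OF s] and hm' = torsion_sequence_hom[OF s']
  have adj: "adjunction D D (Susp P) (Loop P) (Unit P) (Counit P)"
    and rt: "right_triangulated D (Susp P) (RTri P)"
    and lt: "right_triangulated (opposite D) (Loop P) {(h, g, f) | f g h. (f, g, h) \<in> LTri P}"
    using pre unfolding pretriangulated_def left_triangulated_def by blast+
  interpret op: additive "opposite D" by (rule additive_locale_opposite)
  have opXY: "torsion_theory (opposite D) X Y" and opYX: "torsion_theory (opposite D) Y X"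
    using torsion_theory_opposite XY YX by blast+
  have "(e', h', Neg D (FArr (Susp P) d')) \<in> RTri P" using right_triangle_rotate[OF rt R'] .
  moreover have "Cod D h' \<in> Y"
    using SY[OF hm'(3)] hom_Arr(3)[OF right_triangle_hom(3)[OF rt R']] by simp
  ultimately have right: "\<exists>b c. (e' \<cdot> d, b, c) \<in> RTri P \<and> zero_object D (Cod D b)"
    using composite_cone_zero[OF rt XY YX SX SY hm(1,3) hm'(2,4) R] hm(4) by blast
  let ?T = "{(h, g, f) | f g h. (f, g, h) \<in> LTri P}"
  have opL: "(e, d, k) \<in> ?T" and opL': "(e', d', k') \<in> ?T" using L L' by blast+
  have "(d, k, Neg (opposite D) (FArr (Loop P) e)) \<in> ?T" using op.right_triangle_rotate[OF lt opL] .
  moreover have "Dom D k \<in> Y"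
    using op.right_triangle_hom(3)[OF lt opL] loop_closed[OF adj XY SX hm(4)] by (simp add: Hom_def)
  ultimately have "\<exists>b c. (e' \<cdot> d, b, c) \<in> ?T \<and> zero_object D (Dom D b)"
    using op.composite_cone_zero[OF lt opXY opYX loop_closed[OF adj YX SY] loop_closed[OF adj XY SX],
        of e' "Cod D e'" M d "Dom D d" d' k' k] hm hm' opL' by simp
  then have "\<exists>a b. (a, b, e' \<cdot> d) \<in> LTri P \<and> zero_object D (Dom D b)" by blast
  then show ?thesis
    using bal right hom_Arr(1)[OF comp_hom[OF hm'(2) hm(1)]] unfolding weakly_balanced_def by blast
qed

lemma split_if_canonical_factorizations:
  assumes can: "canonical_factorizations D" and tp: "torsion_pair D X Y" "torsion_pair D Y X"
  shows "split_torsion_pair D X Y"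
proof (rule split_torsion_pairI[OF tp(1)])
  fix M assume M: "M \<in> Ob D"
  have XY: "torsion_theory D X Y" and YX: "torsion_theory D Y X"
    using tp torsion_pair_torsion_theory by blast+
  obtain d e d' e' where s: "torsion_sequence D X Y M d e" and s': "torsion_sequence D Y X M d' e'"
    using XY YX M unfolding torsion_theory_def by blast
  have "is_section D d"
    using section_if_comparison_iso[OF s s'] mono_epi_iso[OF can]
      comparison_mono[OF XY YX s s'] comparison_epi[OF XY YX s s'] by blast
  then show "\<exists>d. coreflection D X M d \<and> is_section D d"
    using s unfolding torsion_sequence_def by blast
qed

lemma split_if_pretriangulated:
  assumes pre: "pretriangulated D P" "weakly_balanced D P"
    and ptp: "pretriangulated_torsion_pair D P X Y" "pretriangulated_torsion_pair D P Y X"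
  shows "split_torsion_pair D X Y"
proof (rule split_torsion_pairI)
  show tp: "torsion_pair D X Y" using ptp(1) by (simp add: pretriangulated_torsion_pair_def)
  have tp': "torsion_pair D Y X" using ptp(2) by (simp add: pretriangulated_torsion_pair_def)
  fix M assume M: "M \<in> Ob D"
  obtain \<tau> \<delta> \<sigma> \<eta> where a: "inclusion_right_adjoint D X \<tau> \<delta>" "inclusion_left_adjoint D Y \<sigma> \<eta>"
      "weakly_exact D (\<delta> M) (\<eta> M)"
    using tp M unfolding torsion_pair_def by blast
  obtain \<tau>' \<delta>' \<sigma>' \<eta>' where a': "inclusion_right_adjoint D Y \<tau>' \<delta>'" "inclusion_left_adjoint D X \<sigma>' \<eta>'"
      "weakly_exact D (\<delta>' M) (\<eta>' M)"
    using tp' M unfolding torsion_pair_def by blast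
  have s: "torsion_sequence D X Y M (\<delta> M) (\<eta> M)" and s': "torsion_sequence D Y X M (\<delta>' M) (\<eta>' M)"
    using adjoints_torsion_sequence a a' M by blast+
  obtain h k where t: "(\<delta> M, \<eta> M, h) \<in> RTri P" "(k, \<delta> M, \<eta> M) \<in> LTri P"
    using ptp(1) a(1,2) M unfolding pretriangulated_torsion_pair_def by blast
  obtain h' k' where t': "(\<delta>' M, \<eta>' M, h') \<in> RTri P" "(k', \<delta>' M, \<eta>' M) \<in> LTri P"
    using ptp(2) a'(1,2) M unfolding pretriangulated_torsion_pair_def by blast
  have "is_iso D (\<eta>' M \<cdot> \<delta> M)"
    using pretriangulated_comparison_iso[OF pre torsion_pair_torsion_theory[OF tp]
        torsion_pair_torsion_theory[OF tp'] _ _ s s' t(1) t'(1) t(2) t'(2)] ptp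
    unfolding pretriangulated_torsion_pair_def by blast
  then have "is_section D (\<delta> M)" using section_if_comparison_iso[OF s s'] by blast
  then show "\<exists>d. coreflection D X M d \<and> is_section D d"
    using s unfolding torsion_sequence_def by blast
qed

end

theorem proposition1p6p4:
  fixes D :: "('o, 'a) addcat"
    and X Y Z :: "'o set"
  assumes "additive_category D"
    and "TTF_triple D X Y Z"
  shows "(left_split D X Y Z \<and> X = Z \<longleftrightarrow> right_split D X Y Z \<and> X = Z) \<and>
         (right_split D X Y Z \<and> X = Z \<longleftrightarrow> centrally_split D X Y Z) \<and>
         (canonical_factorizations D \<or>
          (\<exists>P. pretriangulated D P \<and> weakly_balanced D P \<and>
               pretriangulated_torsion_pair D P X Y \<and> pretriangulated_torsion_pair D P Y Z)
          \<longrightarrow> (centrally_split D X Y Z \<longleftrightarrow> X = Z))"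
proof -
  interpret additive D using assms(1) by unfold_locales
  have tp: "torsion_pair D X Y" "torsion_pair D Y Z" using assms(2) by (simp_all add: TTF_triple_def)
  have left: "left_split D X Y Z \<longleftrightarrow> split_torsion_pair D X Y"
    and right: "right_split D X Y Z \<longleftrightarrow> split_torsion_pair D Y Z"
    using assms(2) by (simp_all add: left_split_def right_split_def)
  have flip: "split_torsion_pair D X Y \<longleftrightarrow> split_torsion_pair D Y Z" if "X = Z"
    using split_flip tp that by blast
  have central: "X = Z" if "centrally_split D X Y Z"
    using split_TTF_outer_eq that left right unfolding centrally_split_def by blast
  have "split_torsion_pair D X Y"
    if "canonical_factorizations D \<or>
          (\<exists>P. pretriangulated D P \<and> weakly_balanced D P \<and>
               pretriangulated_torsion_pair D P X Y \<and> pretriangulated_torsion_pair D P Y Z)" "X = Z"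
    using that split_if_canonical_factorizations split_if_pretriangulated tp by blast
  then show ?thesis
    using flip central left right unfolding centrally_split_def by blast
qed

end
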